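(* Let $X$ be a Banach space of type $p$, $1<p\le2$, and let $p'<r<\infty$, $0<s<\infty$ and $\alpha\in\mathbb R$. Then there exists a constant $c=c(p,r,s,\alpha)>0$ such that for all $N\in\mathbb N$ and all precompact subsets $A\subset X$ with $\varepsilon_1(A)>0$ it holds that $$\sum_{n=1}^N(\log(n+1))^{-\alpha}n^{s/r-1}(e_n(\mathrm{aco}(A)))^s\le c\,c_A^s\sum_{n=1}^N(\log(n+1))^{-\alpha}n^{s/r-1}(e_n(A))^s$$ and $$\sup_{1\le n\le N}(\log(n+1))^{-\alpha}n^{1/r}e_n(\mathrm{aco}(A))\le c\,c_A\sup_{1\le n\le N}(\log(n+1))^{-\alpha}n^{1/r}e_n(A),$$ where $c_A:=\frac{\sup_{x\in A}\|x\|}{\varepsilon_1(A)}$. In the context of Lorentz sequence spaces this implies that for $p'<r<\infty$, $0<s\le\infty$ and $\alpha\in\mathbb R$, and every precompact $A\subset X$, it holds that $$(e_n(A))_n\in l_{r,s,\alpha}\quad\text{if and only if}\quad(e_n(\mathrm{aco}(A)))_n\in l_{r,s,\alpha}.$$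
   Context: $p'$ is the conjugate exponent, $1/p+1/p'=1$. $\log$ is the logarithm to base 2. $\mathrm{aco}(A)$ is the absolutely convex hull of $A$. A Banach space $X$ is of type $p$, $1\le p\le2$, if there is $\varrho>0$ with $\int_0^1\|\sum_{i=1}^k r_i(t)x_i\|\,dt\le\varrho(\sum_{i=1}^k\|x_i\|^p)^{1/p}$ for all $k\in\mathbb N$ and $x_1,\dots,x_k\in X$, where $r_i(t)=\mathrm{sign}(\sin(2^i\pi t))$. The space $X$ is fixed in the theorem. Entropy numbers: for a bounded subset $A$ of a metric space $M$, $\varepsilon_n(A)=\inf\{\varepsilon\ge0:\exists x_1,\dots,x_n\in M,\ A\subset\bigcup_{i=1}^n B_M(x_i,\varepsilon)\}$ with closed balls $B_M(x,\varepsilon)$, and the dyadic entropy numbers are $e_n(A)=\varepsilon_{2^{n-1}}(A)$. Generalized Lorentz sequence spaces: for $0<r<\infty$, $0<s\le\infty$, $\alpha\in\mathbb R$, a non-increasing bounded sequence $(\xi_n)_{n\ge1}$ of non-negative reals belongs to $l_{r,s,\alpha}$ iff $\sum_{n=1}^\infty(\log(n+1))^{-\alpha s}n^{s/r-1}\xi_n^s<\infty$ (if $s<\infty$), respectively $\sup_{n}(\log(n+1))^{-\alpha}n^{1/r}\xi_n<\infty$ (if $s=\infty$). *)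

theory Defs
  imports "HOL-Analysis.Analysis"
begin

definition rademacher :: "nat \<Rightarrow> real \<Rightarrow> real"
  where "rademacher i t = sgn (sin (2 ^ i * pi * t))"

definition banach_type :: "'a::banach itself \<Rightarrow> real \<Rightarrow> bool"
  where "banach_type _ p \<longleftrightarrow> 1 \<le> p \<and> p \<le> 2 \<and>
    (\<exists>\<rho>>0. \<forall>(k::nat) (x :: nat \<Rightarrow> 'a).
      integral {0..1} (\<lambda>t. norm (\<Sum>i=1..k. rademacher i t *\<^sub>R x i))
        \<le> \<rho> * (\<Sum>i=1..k. norm (x i) powr p) powr (1 / p))"

text \<open>The absolutely convex hull of \<open>A\<close> (over the reals) is \<open>absolutely_convex hull A\<close>, the smallest
  absolutely convex set containing \<open>A\<close>; only the degenerate hull of the empty set depends on whether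
  the empty set itself counts as absolutely convex.\<close>

definition absolutely_convex :: "'a::real_vector set \<Rightarrow> bool"
  where "absolutely_convex S \<longleftrightarrow>
    (\<forall>x\<in>S. \<forall>y\<in>S. \<forall>a b :: real. \<bar>a\<bar> + \<bar>b\<bar> \<le> 1 \<longrightarrow> a *\<^sub>R x + b *\<^sub>R y \<in> S)"

lemma absolutely_convex_Inter:
  "(\<And>S. S \<in> \<F> \<Longrightarrow> absolutely_convex S) \<Longrightarrow> absolutely_convex (\<Inter>\<F>)"
  unfolding absolutely_convex_def by blast

lemma absolutely_convex_hull: "absolutely_convex (absolutely_convex hull A)"
  by (metis absolutely_convex_Inter hull_in)

text \<open>The entropy numbers are meaningful for bounded \<open>A\<close> and \<open>n \<ge> 1\<close>; the centres are points of the
  whole space and need not be distinct. The dyadic ones are indexed from \<open>1\<close>.\<close>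

definition entropy_number :: "nat \<Rightarrow> 'a::metric_space set \<Rightarrow> real"
  where "entropy_number n A =
    Inf {\<epsilon>. 0 \<le> \<epsilon> \<and> (\<exists>x :: nat \<Rightarrow> 'a. A \<subseteq> (\<Union>i\<in>{1..n}. cball (x i) \<epsilon>))}"

definition dyadic_entropy_number :: "nat \<Rightarrow> 'a::metric_space set \<Rightarrow> real"
  where "dyadic_entropy_number n A = entropy_number (2 ^ (n - 1)) A"

text \<open>Sequences are indexed from \<open>1\<close>; the value at \<open>0\<close> is irrelevant. The series has non-negative
  terms, so its finiteness is summability.\<close>

definition lorentz_seq :: "real \<Rightarrow> ereal \<Rightarrow> real \<Rightarrow> (nat \<Rightarrow> real) set"
  where "lorentz_seq r s \<alpha> = {\<xi>.
    antimono_on {1..} \<xi> \<and> (\<forall>n\<ge>1. 0 \<le> \<xi> n) \<and> bounded (\<xi> ` {1..}) \<and>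
    (if s = \<infinity>
     then bdd_above ((\<lambda>n. (log 2 (real n + 1)) powr (- \<alpha>) * real n powr (1 / r) * \<xi> n) ` {1..})
     else (let s' = real_of_ereal s in
       (\<lambda>n. (log 2 (real n + 1)) powr (- \<alpha> * s') * real n powr (s' / r - 1) * \<xi> n powr s')
         summable_on {1..}))}"

end

theory Submission
  imports Defs
begin

text \<open>
  Everything rests on one estimate. Put \<open>u = 1 - 1 / p = 1 / p'\<close>. For every exponent \<open>0 < \<beta> < u\<close>, the decay
  \<open>e\<^sub>k(A) \<le> T k\<^sup>-\<^sup>\<beta>\<close> for \<open>k \<le> n\<close>, together with \<open>\<parallel>x\<parallel> \<le> T\<close> on \<open>A\<close>, passes to the absolutely convex hull at the
  price of a constant factor: \<open>e\<^sub>n(aco A) \<le> C T n\<^sup>-\<^sup>\<beta>\<close> (\<open>entropy_absolutely_convex_hull\<close>). The constant depends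
  on the space and on \<open>\<beta>\<close> only.

  The estimate comes from chaining. Nets of \<open>A\<close> of cardinality \<open>2 ^ 2 ^ j\<close> and radius \<open>T 2\<^sup>-\<^sup>\<beta>\<^sup>j\<close> for
  \<open>j \<le> J\<close> write each point of \<open>A\<close> as a sum of increments plus a remainder of norm at most \<open>T 2\<^sup>-\<^sup>\<beta>\<^sup>J\<close>. At level
  \<open>j\<close> the increments form a finite set \<open>D\<^sub>j\<close>, with norms at most \<open>4 T 2\<^sup>-\<^sup>\<beta>\<^sup>j\<close>. Hence \<open>aco A\<close> lies in the
  Minkowski sum of the sets \<open>aco D\<^sub>j\<close> and a small ball. By Maurey's lemma (\<open>maurey_covers\<close>) the averages
  of \<open>m\<close> points of \<open>D \<union> -D \<union> {0}\<close> approximate all of \<open>aco D\<close> up to a multiple of \<open>d m\<^sup>-\<^sup>u\<close>, if \<open>d\<close> bounds the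
  norms on \<open>D\<close>; there are few such averages. The numbers \<open>m\<^sub>j\<close> are about \<open>2 ^ (\<tau> (J - j))\<close> with \<open>\<tau> < 1\<close> and \<open>\<beta> < \<tau> u\<close>: the first
  condition keeps the logarithm of the number of centres of order \<open>2 ^ J\<close>, the second one makes the errors sum to
  order \<open>2\<^sup>-\<^sup>\<beta>\<^sup>J\<close>. The strict inequality \<open>\<beta> < u\<close> leaves room for both.

  Maurey's lemma is usually proved with independent random variables. Here an average of \<open>2 m\<close> points is
  thinned to an average of \<open>m\<close> points: signs with a small signed sum exist, since some choice of signs does not
  exceed the Rademacher average, and dropping the terms of the majority sign while doubling the weight of the
  others changes the average only by the normalised signed sum. Starting with a very long average and halving repeatedly, the errors
  form a geometric series.

  For the theorem choose \<open>1 / r < \<beta> < u\<close>. Then \<open>e\<^sub>n(aco A) \<le> C (k / n)\<^sup>\<beta> a\<^sub>k\<close> for some \<open>k \<le> n\<close>, where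
  \<open>a\<^sub>1 = sup \<parallel>x\<parallel>\<close> and \<open>a\<^sub>k = e\<^sub>k(A)\<close> otherwise. Since \<open>\<beta> > 1 / r\<close>, a logarithmically weighted
  inequality of Hardy type (\<open>log_weighted_hardy_sum\<close>, \<open>log_weighted_hardy_term\<close>) turns this pointwise bound into the bounds
  for sums and suprema. The ratio \<open>c\<^sub>A\<close> enters as the cost of replacing \<open>a\<^sub>1\<close> by \<open>e\<^sub>1(A)\<close>. For membership in
  a Lorentz space a single term does not matter, so sets with \<open>e\<^sub>1(A) = 0\<close> cause no trouble, and the converse direction holds
  because \<open>A\<close> is contained in its hull.\<close>

section \<open>Covering numbers and entropy numbers\<close>

text \<open>A finite set of centres, in place of an indexed family, is stable under images and Minkowski
  sums, which is what the covering arguments need.\<close>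

definition covers :: "nat \<Rightarrow> real \<Rightarrow> 'a::metric_space set \<Rightarrow> bool"
  where "covers n r A \<longleftrightarrow> (\<exists>C. finite C \<and> card C \<le> n \<and> A \<subseteq> (\<Union>c\<in>C. cball c r))"

lemma covers_mono:
  assumes "covers n r A" "B \<subseteq> A" "n \<le> m" "r \<le> s"
  shows "covers m s B"
proof -
  from assms(1) obtain C where C: "finite C" "card C \<le> n" "A \<subseteq> (\<Union>c\<in>C. cball c r)"
    unfolding covers_def by blast
  have "(\<Union>c\<in>C. cball c r) \<subseteq> (\<Union>c\<in>C. cball c s)"
    using assms(4) by (intro UN_mono subset_cball) auto
  with assms(2) C(3) have "B \<subseteq> (\<Union>c\<in>C. cball c s)"
    by (meson subset_trans)
  then show ?thesis
    unfolding covers_def using C assms(3) by (meson le_trans)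
qed

lemma covers_cball: "1 \<le> n \<Longrightarrow> covers n r (cball x r)"
  unfolding covers_def by (intro exI[of _ "{x}"]) auto

lemma covers_plus:
  fixes S T :: "'a::real_normed_vector set"
  assumes "covers n r S" "covers m s T"
  shows "covers (n * m) (r + s) (S + T)"
proof -
  from assms obtain C D where C: "finite C" "card C \<le> n" "S \<subseteq> (\<Union>c\<in>C. cball c r)"
    and D: "finite D" "card D \<le> m" "T \<subseteq> (\<Union>c\<in>D. cball c s)"
    unfolding covers_def by blast
  let ?F = "(\<lambda>(c, d). c + d) ` (C \<times> D)"
  have "card ?F \<le> card (C \<times> D)"
    using C D by (intro card_image_le) auto
  also have "\<dots> \<le> n * m"
    using C D by (simp add: card_cartesian_product mult_le_mono)
  finally have "card ?F \<le> n * m" .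
  moreover have "S + T \<subseteq> (\<Union>c\<in>?F. cball c (r + s))"
  proof
    fix z assume "z \<in> S + T"
    then obtain x y where xy: "x \<in> S" "y \<in> T" "z = x + y"
      by (auto simp: set_plus_def)
    then obtain c d where cd: "c \<in> C" "dist c x \<le> r" "d \<in> D" "dist d y \<le> s"
      using C D by fastforce
    have "dist (c + d) z \<le> r + s"
      unfolding xy(3) using dist_triangle_add[of c d x y] cd by linarith
    then show "z \<in> (\<Union>c\<in>?F. cball c (r + s))"
      using cd by force
  qed
  ultimately show ?thesis
    unfolding covers_def using C D by (intro exI[of _ ?F]) auto
qed

lemma entropy_radius_of_covers:
  assumes "covers n r A"
  shows "\<exists>x :: nat \<Rightarrow> 'a::metric_space. A \<subseteq> (\<Union>i\<in>{1..n}. cball (x i) r)"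
proof -
  from assms obtain C where C: "finite C" "card C \<le> n" "A \<subseteq> (\<Union>c\<in>C. cball c r)"
    unfolding covers_def by blast
  obtain h where "bij_betw h {1..card C} C"
    using ex_bij_betw_nat_finite_1[OF C(1)] by blast
  then have "C \<subseteq> h ` {1..n}"
    using C(2) by (force simp: bij_betw_def)
  then have "A \<subseteq> (\<Union>i\<in>{1..n}. cball (h i) r)"
    using C(3) by blast
  then show ?thesis by blast
qed

lemma bounded_imp_covers:
  assumes "bounded A" "1 \<le> n"
  shows "\<exists>r\<ge>0. covers n r A"
proof -
  obtain x e where e: "A \<subseteq> cball x e"
    using assms(1) by (auto simp: bounded_subset_cball)
  have "A \<subseteq> cball x (max e 0)"
    using e by force
  then show ?thesis
    using covers_mono[OF covers_cball[OF assms(2), of "max e 0" x]]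
    by (meson max.cobounded2 order_refl)
qed

lemma entropy_radii_nonempty:
  assumes "bounded A" "1 \<le> n"
  shows "{\<epsilon>. 0 \<le> \<epsilon> \<and> (\<exists>x :: nat \<Rightarrow> 'a::metric_space. A \<subseteq> (\<Union>i\<in>{1..n}. cball (x i) \<epsilon>))} \<noteq> {}"
    (is "?E \<noteq> {}")
proof -
  obtain r where r: "0 \<le> r" "covers n r A"
    using bounded_imp_covers[OF assms] by (elim exE conjE)
  have "r \<in> ?E"
    using r(1) entropy_radius_of_covers[OF r(2)] by simp
  then show ?thesis by (metis empty_iff)
qed

lemma entropy_number_le:
  assumes "covers n r A" "0 \<le> r"
  shows "entropy_number n A \<le> r"
  unfolding entropy_number_def
proof (rule cInf_lower)
  show "r \<in> {\<epsilon>. 0 \<le> \<epsilon> \<and> (\<exists>x :: nat \<Rightarrow> 'a. A \<subseteq> (\<Union>i\<in>{1..n}. cball (x i) \<epsilon>))}"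
    using entropy_radius_of_covers[OF assms(1)] assms(2) by simp
  show "bdd_below {\<epsilon>. 0 \<le> \<epsilon> \<and> (\<exists>x :: nat \<Rightarrow> 'a. A \<subseteq> (\<Union>i\<in>{1..n}. cball (x i) \<epsilon>))}"
    by (auto intro: bdd_belowI)
qed

lemma nonempty_of_entropy_number_pos:
  assumes "0 < entropy_number n A"
  shows "A \<noteq> {}"
proof
  assume "A = {}"
  then have "entropy_number n A \<le> 0"
    by (intro entropy_number_le) (auto simp: covers_def)
  with assms show False by simp
qed

lemma covers_of_entropy_number_less:
  assumes "bounded A" "1 \<le> n" "entropy_number n A < r"
  shows "covers n r A"
proof -
  let ?E = "{\<epsilon>. 0 \<le> \<epsilon> \<and> (\<exists>x :: nat \<Rightarrow> 'a. A \<subseteq> (\<Union>i\<in>{1..n}. cball (x i) \<epsilon>))}"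
  obtain e where e: "e \<in> ?E" "e < r"
    using assms(3) entropy_radii_nonempty[OF assms(1,2)] unfolding entropy_number_def by (meson cInf_lessD)
  then obtain x :: "nat \<Rightarrow> 'a" where x: "A \<subseteq> (\<Union>i\<in>{1..n}. cball (x i) e)"
    by blast
  have "covers n e A"
    unfolding covers_def
    using x card_image_le[of "{1..n}" x] by (intro exI[of _ "x ` {1..n}"]) auto
  then show ?thesis
    using e(2) by (rule_tac covers_mono) auto
qed

lemma entropy_number_nonneg:
  assumes "bounded A" "1 \<le> n"
  shows "0 \<le> entropy_number n A"
  unfolding entropy_number_def
by (rule cInf_greatest[OF entropy_radii_nonempty[OF assms]]) simp

lemma entropy_number_mono:
  assumes "bounded B" "A \<subseteq> B" "1 \<le> n" "n \<le> m"
  shows "entropy_number m A \<le> entropy_number n B"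
proof (rule dense_ge)
  fix r assume r: "entropy_number n B < r"
  then have "covers m r A"
    using covers_mono[OF covers_of_entropy_number_less[OF assms(1,3) r]] assms by blast
  moreover have "0 \<le> r"
    using r entropy_number_nonneg[OF assms(1,3)] by linarith
  ultimately show "entropy_number m A \<le> r"
    by (rule entropy_number_le)
qed

lemma dyadic_entropy_number_nonneg: "bounded A \<Longrightarrow> 0 \<le> dyadic_entropy_number n A"
  unfolding dyadic_entropy_number_def by (rule entropy_number_nonneg) auto

lemma dyadic_entropy_number_mono:
  assumes "bounded B" "A \<subseteq> B" "n \<le> m"
  shows "dyadic_entropy_number m A \<le> dyadic_entropy_number n B"
  unfolding dyadic_entropy_number_def
  using assms by (intro entropy_number_mono) (auto intro: power_increasing)

lemma dyadic_entropy_number_le: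
  assumes "\<And>x. x \<in> A \<Longrightarrow> norm x \<le> R" "0 \<le> R"
  shows "dyadic_entropy_number n (A :: 'a::real_normed_vector set) \<le> R"
  unfolding dyadic_entropy_number_def
proof (rule entropy_number_le[OF _ assms(2)])
  show "covers (2 ^ (n - 1)) R A"
    using assms(1) by (intro covers_mono[OF covers_cball[of 1 R 0]]) auto
qed

lemma totally_bounded_imp_bounded:
  assumes "totally_bounded (A :: 'a::metric_space set)"
  shows "bounded A"
proof -
  obtain k where k: "finite k" "A \<subseteq> (\<Union>x\<in>k. {y. dist x y < 1})"
    using assms unfolding totally_bounded_metric by (meson zero_less_one)
  have "bounded (\<Union>x\<in>k. ball x 1)"
    using k(1) by auto
  then show ?thesis
    using k(2) by (auto simp: ball_def intro: bounded_subset)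
qed

section \<open>Absolutely convex sets\<close>

lemma absolutely_convex_plus:
  assumes "absolutely_convex S" "absolutely_convex T"
  shows "absolutely_convex (S + T)"
  unfolding absolutely_convex_def
proof safe
  fix x y and a b :: real
  assume "x \<in> S + T" "y \<in> S + T" and ab: "\<bar>a\<bar> + \<bar>b\<bar> \<le> 1"
  then obtain s t s' t' where xy: "x = s + t" "y = s' + t'" "s \<in> S" "t \<in> T" "s' \<in> S" "t' \<in> T"
    by (auto simp: set_plus_def)
  have "a *\<^sub>R x + b *\<^sub>R y = (a *\<^sub>R s + b *\<^sub>R s') + (a *\<^sub>R t + b *\<^sub>R t')"
    by (simp add: xy algebra_simps)
  also have "\<dots> \<in> S + T"
    using assms xy ab unfolding absolutely_convex_def by (intro set_plus_intro) auto
  finally show "a *\<^sub>R x + b *\<^sub>R y \<in> S + T" .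
qed

lemma absolutely_convex_cball_0:
  "absolutely_convex (cball (0 :: 'a::real_normed_vector) r)"
  unfolding absolutely_convex_def
proof safe
  fix x y :: 'a and a b :: real
  assume x: "x \<in> cball 0 r" and y: "y \<in> cball 0 r" and ab: "\<bar>a\<bar> + \<bar>b\<bar> \<le> 1"
  have r: "0 \<le> r"
    using x norm_ge_zero[of x] by (simp del: norm_ge_zero)
  have "norm (a *\<^sub>R x + b *\<^sub>R y) \<le> \<bar>a\<bar> * norm x + \<bar>b\<bar> * norm y"
    by (metis norm_scaleR norm_triangle_ineq)
  also have "\<dots> \<le> \<bar>a\<bar> * r + \<bar>b\<bar> * r"
    using x y by (intro add_mono mult_left_mono) auto
  also have "\<dots> = (\<bar>a\<bar> + \<bar>b\<bar>) * r"
    by (simp add: algebra_simps)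
  also have "\<dots> \<le> r"
    using mult_right_mono[OF ab r] by simp
  finally show "a *\<^sub>R x + b *\<^sub>R y \<in> cball 0 r" by simp
qed

lemma norm_le_on_absolutely_convex_hull:
  assumes "\<And>x. x \<in> A \<Longrightarrow> norm x \<le> R" "x \<in> absolutely_convex hull A"
  shows "norm (x :: 'a::real_normed_vector) \<le> R"
proof -
  have "absolutely_convex hull A \<subseteq> cball 0 R"
    using assms(1) by (intro hull_minimal absolutely_convex_cball_0) auto
  then show ?thesis using assms(2) by auto
qed

lemma bounded_absolutely_convex_hull:
  "bounded A \<Longrightarrow> bounded (absolutely_convex hull (A :: 'a::real_normed_vector set))"
  unfolding bounded_iff by (meson norm_le_on_absolutely_convex_hull)

text \<open>The combinations on the right form an absolutely convex set, because the \<open>\<ell>\<^sup>1\<close> unit ball of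
  coefficients is absolutely convex.\<close>

lemma absolutely_convex_hull_finite_subset:
  fixes D :: "'a::real_vector set"
  assumes "finite D"
  shows "absolutely_convex hull D \<subseteq> {\<Sum>x\<in>D. t x *\<^sub>R x | t. (\<Sum>x\<in>D. \<bar>t x\<bar>) \<le> 1}"
    (is "_ \<subseteq> ?H")
proof (rule hull_minimal)
  show "D \<subseteq> ?H"
  proof
    fix x assume x: "x \<in> D"
    have "(\<Sum>y\<in>D. (if y = x then 1 else 0) *\<^sub>R y) = (\<Sum>y\<in>D. if y = x then y else 0)"
      by (rule sum.cong) auto
    moreover have "(\<Sum>y\<in>D. \<bar>if y = x then 1 else 0 :: real\<bar>) = (\<Sum>y\<in>D. if y = x then 1 else 0)"
      by (rule sum.cong) auto
    ultimately show "x \<in> ?H"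
      using x assms by (intro CollectI exI[of _ "\<lambda>y. if y = x then 1 else 0"]) auto
  qed
  show "absolutely_convex ?H"
    unfolding absolutely_convex_def
  proof (intro ballI allI impI)
    fix x y and a b :: real
    assume "x \<in> ?H" "y \<in> ?H" and ab: "\<bar>a\<bar> + \<bar>b\<bar> \<le> 1"
    then obtain t u where t: "x = (\<Sum>z\<in>D. t z *\<^sub>R z)" "(\<Sum>z\<in>D. \<bar>t z\<bar>) \<le> 1"
      and u: "y = (\<Sum>z\<in>D. u z *\<^sub>R z)" "(\<Sum>z\<in>D. \<bar>u z\<bar>) \<le> 1" by blast
    let ?v = "\<lambda>z. a * t z + b * u z"
    have "(\<Sum>z\<in>D. \<bar>?v z\<bar>) \<le> (\<Sum>z\<in>D. \<bar>a\<bar> * \<bar>t z\<bar> + \<bar>b\<bar> * \<bar>u z\<bar>)"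
      by (intro sum_mono) (metis abs_mult abs_triangle_ineq)
    also have "\<dots> = \<bar>a\<bar> * (\<Sum>z\<in>D. \<bar>t z\<bar>) + \<bar>b\<bar> * (\<Sum>z\<in>D. \<bar>u z\<bar>)"
      by (simp add: sum.distrib sum_distrib_left)
    also have "\<dots> \<le> \<bar>a\<bar> * 1 + \<bar>b\<bar> * 1"
      using t u by (intro add_mono mult_left_mono) auto
    finally have "(\<Sum>z\<in>D. \<bar>?v z\<bar>) \<le> 1" using ab by simp
    moreover have "a *\<^sub>R x + b *\<^sub>R y = (\<Sum>z\<in>D. ?v z *\<^sub>R z)"
      by (simp add: t u scaleR_sum_right sum.distrib scaleR_add_left)
    ultimately show "a *\<^sub>R x + b *\<^sub>R y \<in> ?H"
      by (intro CollectI exI[of _ ?v]) simp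
  qed
qed

section \<open>Type and the choice of signs\<close>

text \<open>A Rademacher function vanishes only at dyadic points, so these values do not affect integrals.\<close>

lemma finite_rademacher_zeros: "finite {t \<in> {0..1}. \<exists>i\<in>{1..k}. rademacher i t = 0}"
proof -
  have "{t \<in> {0..1}. \<exists>i\<in>{1..k}. rademacher i t = 0}
      \<subseteq> (\<Union>i\<in>{1..k}. (\<lambda>m::int. m / 2 ^ i) ` {0..2 ^ i})"
  proof
    fix t :: real assume "t \<in> {t \<in> {0..1}. \<exists>i\<in>{1..k}. rademacher i t = 0}"
    then obtain i where t: "0 \<le> t" "t \<le> 1" "i \<in> {1..k}" "sin (2 ^ i * pi * t) = 0"
      by (auto simp: rademacher_def sgn_zero_iff)
    then obtain m :: int where "2 ^ i * pi * t = m * pi"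
      by (auto simp: sin_zero_iff_int2)
    then have m: "m = 2 ^ i * t" by simp
    have "0 \<le> real_of_int m" unfolding m using t by simp
    moreover have "real_of_int m \<le> 2 ^ i" unfolding m using t by simp
    ultimately have "m \<in> {0..2 ^ i}" by auto
    moreover have "t = m / 2 ^ i" using m by simp
    ultimately show "t \<in> (\<Union>i\<in>{1..k}. (\<lambda>m::int. m / 2 ^ i) ` {0..2 ^ i})"
      using t by blast
  qed
  then show ?thesis by (rule finite_subset) auto
qed

text \<open>The space need not be separable, so measurability is obtained from the fact that the function
  takes finitely many values.\<close>

lemma rademacher_norm_integrable:
  fixes x :: "nat \<Rightarrow> 'a::real_normed_vector"
  shows "(\<lambda>t. norm (\<Sum>i=1..k. rademacher i t *\<^sub>R x i)) integrable_on {0..1}"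
proof -
  let ?f = "\<lambda>t. norm (\<Sum>i=1..k. rademacher i t *\<^sub>R x i)"
  have r: "simple_function lborel (rademacher i)" for i
  proof -
    have "rademacher i ` space lborel \<subseteq> {-1, 0, 1}"
      by (auto simp: rademacher_def sgn_if)
    then have "finite (rademacher i ` space lborel)"
      by (rule finite_subset) simp
    moreover have "rademacher i \<in> borel_measurable lborel"
      unfolding rademacher_def by measurable
    ultimately show ?thesis
      by (simp add: simple_function_iff_borel_measurable)
  qed
  have "simple_function lborel ?f"
    by (intro simple_function_compose1[where g = norm] simple_function_sum
        simple_function_compose1[where g = "\<lambda>c. c *\<^sub>R _"] r)
  then have "?f \<in> borel_measurable lborel"
    by (rule borel_measurable_simple_function)
  then have meas: "?f \<in> borel_measurable (lebesgue_on {0..1})"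
    by (intro measurable_restrict_space1 measurable_completion)
  have "?f t \<le> (\<Sum>i=1..k. norm (x i))" for t
  proof -
    have "?f t \<le> (\<Sum>i=1..k. norm (rademacher i t *\<^sub>R x i))"
      by (rule norm_sum)
    also have "\<dots> \<le> (\<Sum>i=1..k. norm (x i))"
      by (intro sum_mono) (auto simp: rademacher_def sgn_if)
    finally show ?thesis .
  qed
  then show ?thesis
    by (intro measurable_bounded_by_integrable_imp_integrable[OF meas, where g = "\<lambda>_. \<Sum>i=1..k. norm (x i)"])
       (auto simp: integrable_const_ivl)
qed

text \<open>Off the finite exceptional set all Rademacher values are signs, so the average is at least the
  minimum over all choices of signs.\<close>

lemma exists_signs_le_rademacher_average:
  fixes x :: "nat \<Rightarrow> 'a::real_normed_vector"
  shows "\<exists>\<sigma> :: nat \<Rightarrow> real. (\<forall>i. \<sigma> i \<in> {-1, 1}) \<and>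
    norm (\<Sum>i=1..k. \<sigma> i *\<^sub>R x i)
      \<le> integral {0..1} (\<lambda>t. norm (\<Sum>i=1..k. rademacher i t *\<^sub>R x i))"
proof -
  let ?f = "\<lambda>t. norm (\<Sum>i=1..k. rademacher i t *\<^sub>R x i)"
  let ?P = "PiE {1..k} (\<lambda>_. {-1, 1 :: real})"
  let ?g = "\<lambda>\<sigma>. norm (\<Sum>i=1..k. \<sigma> i *\<^sub>R x i)"
  have "finite ?P" by (intro finite_PiE) auto
  have "?P \<noteq> {}" by (simp add: PiE_eq_empty_iff)
  define b where "b = Min (?g ` ?P)"
  have "b \<in> ?g ` ?P"
    unfolding b_def using \<open>finite ?P\<close> \<open>?P \<noteq> {}\<close> by (intro Min_in) auto
  then obtain \<sigma> where \<sigma>: "\<sigma> \<in> ?P" "b = ?g \<sigma>" by blast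
  let ?Z = "{t \<in> {0..1}. \<exists>i\<in>{1..k}. rademacher i t = 0}"
  have "b \<le> ?f t" if t: "t \<in> {0..1} - ?Z" for t
  proof -
    let ?s = "restrict (\<lambda>i. rademacher i t) {1..k}"
    have "?s \<in> ?P" using t by (auto simp: rademacher_def sgn_if split: if_splits)
    then have "b \<le> ?g ?s"
      unfolding b_def using \<open>finite ?P\<close> by (intro Min_le finite_imageI imageI)
    also have "?g ?s = ?f t" by (intro arg_cong[where f = norm] sum.cong) auto
    finally show ?thesis .
  qed
  then have le: "b \<le> (if t \<in> ?Z then b else ?f t)" if "t \<in> {0..1}" for t
    using that by auto
  have "(\<lambda>t. if t \<in> ?Z then b else ?f t) integrable_on {0..1}"
    by (rule integrable_spike_finite[OF finite_rademacher_zeros[of k] _ rademacher_norm_integrable[of x k]]) auto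
  then have "integral {0..1} (\<lambda>t :: real. b) \<le> integral {0..1} (\<lambda>t. if t \<in> ?Z then b else ?f t)"
    using le by (rule integral_le[OF integrable_const_ivl])
  also have "\<dots> = integral {0..1} ?f"
    by (rule integral_spike[OF negligible_finite[OF finite_rademacher_zeros[of k]]]) auto
  finally have "b \<le> integral {0..1} ?f" by simp
  moreover have "norm (\<Sum>i=1..k. (if i \<in> {1..k} then \<sigma> i else 1) *\<^sub>R x i) = b"
    using \<sigma>(2) by (auto intro!: arg_cong[where f = norm] sum.cong)
  moreover have "\<forall>i. (if i \<in> {1..k} then \<sigma> i else 1) \<in> {-1, 1}"
    using PiE_mem[OF \<sigma>(1)] by simp
  ultimately show ?thesis
    by (intro exI[of _ "\<lambda>i. if i \<in> {1..k} then \<sigma> i else 1"] conjI) simp_all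
qed

text \<open>The only consequence of type \<open>p\<close> that the argument uses: a choice of signs that is at least as
  good as the Rademacher average.\<close>

definition sign_type :: "'a::real_normed_vector itself \<Rightarrow> real \<Rightarrow> real \<Rightarrow> bool"
  where "sign_type _ p \<rho> \<longleftrightarrow> (\<forall>k (x :: nat \<Rightarrow> 'a). \<exists>\<sigma> :: nat \<Rightarrow> real. (\<forall>i. \<sigma> i \<in> {-1, 1}) \<and>
    norm (\<Sum>i=1..k. \<sigma> i *\<^sub>R x i) \<le> \<rho> * (\<Sum>i=1..k. norm (x i) powr p) powr (1 / p))"

lemma banach_type_imp_sign_type:
  assumes "banach_type TYPE('a::banach) p"
  obtains \<rho> where "0 < \<rho>"
    "sign_type TYPE('a) p \<rho>"
proof -
  obtain \<rho> where \<rho>: "0 < \<rho>" "\<And>(k::nat) (x :: nat \<Rightarrow> 'a).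
      integral {0..1} (\<lambda>t. norm (\<Sum>i=1..k. rademacher i t *\<^sub>R x i))
        \<le> \<rho> * (\<Sum>i=1..k. norm (x i) powr p) powr (1 / p)"
    using assms unfolding banach_type_def by blast
  have "sign_type TYPE('a) p \<rho>"
    unfolding sign_type_def
  proof (intro allI)
    fix k and x :: "nat \<Rightarrow> 'a"
    show "\<exists>\<sigma> :: nat \<Rightarrow> real. (\<forall>i. \<sigma> i \<in> {-1, 1}) \<and>
      norm (\<Sum>i=1..k. \<sigma> i *\<^sub>R x i) \<le> \<rho> * (\<Sum>i=1..k. norm (x i) powr p) powr (1 / p)"
      using exists_signs_le_rademacher_average[of x k] \<rho>(2)[where k = k and x = x]
      by (meson order_trans)
  qed
  with \<rho>(1) show ?thesis by (rule that)
qed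

section \<open>Maurey's sparsification\<close>

lemma norm_diff_via: "norm (a - c) \<le> norm (a - b) + norm (b - c :: 'a::real_normed_vector)"
  by (metis dist_norm dist_triangle)

lemma sum_list_replicate_scaleR:
  "sum_list (replicate n b) = real n *\<^sub>R (b :: 'a::real_vector)"
  by (induction n) (auto simp: algebra_simps)

text \<open>Let \<open>\<sigma>\<close> be signs with small signed sum, and let \<open>\<tau>\<close> be the minority sign. Keeping the
  terms of sign \<open>\<tau>\<close> and doubling their weight changes the average by \<open>\<plusminus>\<close> the signed sum divided by \<open>2 m\<close>. At most
  \<open>m\<close> terms are kept; zeros fill the list up to length \<open>m\<close>.\<close>

lemma halve_average:
  fixes xs :: "'a::real_normed_vector list"
  assumes signs: "sign_type TYPE('a) p \<rho>"
    and \<rho>: "0 < \<rho>" and p: "1 < p"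
    and xs: "length xs = 2 * m" "set xs \<subseteq> E" and m: "1 \<le> m"
    and E: "0 \<in> E" "\<And>z. z \<in> E \<Longrightarrow> norm z \<le> d"
  shows "\<exists>ys. length ys = m \<and> set ys \<subseteq> E \<and>
    norm (sum_list xs /\<^sub>R real (2 * m) - sum_list ys /\<^sub>R real m)
      \<le> \<rho> * d * real (2 * m) powr (- (1 - 1 / p))"
proof -
  define M where "M = 2 * m"
  have M: "0 < real M" "length xs = M" using m xs by (auto simp: M_def)
  have d: "0 \<le> d" using E(2)[OF E(1)] by simp
  define x where "x i = xs ! (i - 1)" for i
  have xE: "x i \<in> E" if "i \<in> {1..M}" for i
    using that xs(2) M by (auto simp: x_def intro!: subsetD[OF xs(2)] nth_mem)
  have sum_xs: "sum_list xs = (\<Sum>i=1..M. x i)"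
  proof -
    have "sum_list xs = (\<Sum>i=0..<M. xs ! i)"
      by (simp add: sum_list_sum_nth M)
    also have "\<dots> = (\<Sum>i=1..M. x i)"
      by (rule sum.reindex_bij_witness[of _ "\<lambda>i. i - 1" Suc]) (auto simp: x_def)
    finally show ?thesis .
  qed
  from signs have "\<exists>\<sigma> :: nat \<Rightarrow> real. (\<forall>i. \<sigma> i \<in> {-1, 1}) \<and>
      norm (\<Sum>i=1..M. \<sigma> i *\<^sub>R x i) \<le> \<rho> * (\<Sum>i=1..M. norm (x i) powr p) powr (1 / p)"
    unfolding sign_type_def by blast
  then obtain \<sigma> :: "nat \<Rightarrow> real" where \<sigma>: "\<And>i. \<sigma> i \<in> {-1, 1}"
    and le: "norm (\<Sum>i=1..M. \<sigma> i *\<^sub>R x i) \<le> \<rho> * (\<Sum>i=1..M. norm (x i) powr p) powr (1 / p)"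
    by auto
  have "(\<Sum>i=1..M. norm (x i) powr p) \<le> (\<Sum>i=1..M. d powr p)"
    using xE E(2) p by (intro sum_mono powr_mono2) auto
  then have "(\<Sum>i=1..M. norm (x i) powr p) powr (1 / p) \<le> (real M * d powr p) powr (1 / p)"
    using p by (intro powr_mono2) (auto intro: sum_nonneg)
  also have "\<dots> = real M powr (1 / p) * d"
    using p d by (simp add: powr_mult powr_powr)
  finally have "\<rho> * (\<Sum>i=1..M. norm (x i) powr p) powr (1 / p) \<le> \<rho> * (real M powr (1 / p) * d)"
    using \<rho> by (intro mult_left_mono) auto
  with le have le: "norm (\<Sum>i=1..M. \<sigma> i *\<^sub>R x i) \<le> \<rho> * d * real M powr (1 / p)"
    by (simp add: mult_ac)
  have "\<exists>\<tau>\<in>{-1, 1}. card {i \<in> {1..M}. \<sigma> i = \<tau>} \<le> m"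
  proof (rule ccontr)
    assume "\<not> ?thesis"
    then have *: "m < card {i \<in> {1..M}. \<sigma> i = -1}" "m < card {i \<in> {1..M}. \<sigma> i = 1}"
      by auto
    have "card {i \<in> {1..M}. \<sigma> i = -1} + card {i \<in> {1..M}. \<sigma> i = 1}
        = card ({i \<in> {1..M}. \<sigma> i = -1} \<union> {i \<in> {1..M}. \<sigma> i = 1})"
      by (rule card_Un_disjoint[symmetric]) auto
    also have "\<dots> \<le> card {1..M}"
      by (intro card_mono) auto
    finally show False using * by (simp add: M_def)
  qed
  then obtain \<tau> where \<tau>: "\<tau> \<in> {-1, 1}" "card {i \<in> {1..M}. \<sigma> i = \<tau>} \<le> m" by blast
  define I where "I = {i \<in> {1..M}. \<sigma> i = \<tau>}"
  have I: "finite I" "I \<subseteq> {1..M}" "card I \<le> m" using \<tau> by (auto simp: I_def)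
  define ys where "ys = map x (sorted_list_of_set I) @ replicate (m - card I) 0"
  have "length ys = m" using I by (simp add: ys_def)
  moreover have "set ys \<subseteq> E" using I xE E(1) by (auto simp: ys_def)
  moreover have "norm (sum_list xs /\<^sub>R real M - sum_list ys /\<^sub>R real m)
      \<le> \<rho> * d * real M powr (- (1 - 1 / p))"
  proof -
    have "sum_list ys = (\<Sum>i\<in>I. x i)"
      using I by (simp add: ys_def sum_list_distinct_conv_sum_set sum_list_replicate_scaleR)
    also have "\<dots> = (\<Sum>i=1..M. if \<sigma> i = \<tau> then x i else 0)"
      unfolding I_def by (rule sum.inter_filter) simp
    finally have "sum_list ys = (\<Sum>i=1..M. if \<sigma> i = \<tau> then x i else 0)" .
    then have "sum_list xs - 2 *\<^sub>R sum_list ys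
        = (\<Sum>i=1..M. x i - 2 *\<^sub>R (if \<sigma> i = \<tau> then x i else 0))"
      by (simp add: sum_xs sum_subtractf scaleR_sum_right)
    also have "\<dots> = (\<Sum>i=1..M. - \<tau> *\<^sub>R (\<sigma> i *\<^sub>R x i))"
    proof (intro sum.cong refl)
      fix i
      show "x i - 2 *\<^sub>R (if \<sigma> i = \<tau> then x i else 0) = - \<tau> *\<^sub>R (\<sigma> i *\<^sub>R x i)"
        using \<sigma>[of i] \<tau>(1) by (auto simp: scaleR_2)
    qed
    also have "\<dots> = - \<tau> *\<^sub>R (\<Sum>i=1..M. \<sigma> i *\<^sub>R x i)"
      by (simp add: scaleR_sum_right)
    finally have "norm (sum_list xs - 2 *\<^sub>R sum_list ys) = norm (\<Sum>i=1..M. \<sigma> i *\<^sub>R x i)"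
      using \<tau>(1) by auto
    moreover have "sum_list xs /\<^sub>R real M - sum_list ys /\<^sub>R real m
        = (sum_list xs - 2 *\<^sub>R sum_list ys) /\<^sub>R real M"
      using m by (simp add: M_def algebra_simps)
    ultimately have "norm (sum_list xs /\<^sub>R real M - sum_list ys /\<^sub>R real m)
        = norm (\<Sum>i=1..M. \<sigma> i *\<^sub>R x i) / real M"
      using M by (simp add: divide_inverse mult.commute)
    also have "\<dots> \<le> \<rho> * d * real M powr (1 / p) / real M"
      using le M by (intro divide_right_mono) auto
    also have "\<dots> = \<rho> * d * real M powr (- (1 - 1 / p))"
      using M by (simp add: powr_diff)
    finally show ?thesis .
  qed
  ultimately show ?thesis unfolding M_def by blast
qed

lemma geometric_sum_le:
  fixes q :: real
  assumes "0 < q" "q < 1"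
  shows "(\<Sum>i<k. q ^ i) \<le> 1 / (1 - q)"
proof -
  have "(\<Sum>i<k. q ^ i) = (1 - q ^ k) / (1 - q)"
    using assms by (simp add: sum_gp_strict)
  also have "\<dots> \<le> 1 / (1 - q)"
    using assms by (intro divide_right_mono) auto
  finally show ?thesis .
qed

text \<open>Repeated halving; the error of a step that ends at length \<open>2 ^ i * m\<close> is at most
  \<open>\<rho> d m\<^sup>-\<^sup>u 2\<^sup>-\<^sup>u\<^sup>i\<close> with \<open>u = 1 - 1 / p\<close>.\<close>

lemma shorten_average:
  fixes xs :: "'a::real_normed_vector list"
  assumes signs: "sign_type TYPE('a) p \<rho>"
    and \<rho>: "0 < \<rho>" and p: "1 < p"
    and xs: "length xs = 2 ^ k * m" "set xs \<subseteq> E" and m: "1 \<le> m"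
    and E: "0 \<in> E" "\<And>z. z \<in> E \<Longrightarrow> norm z \<le> d"
  shows "\<exists>ys. length ys = m \<and> set ys \<subseteq> E \<and>
    norm (sum_list xs /\<^sub>R real (2 ^ k * m) - sum_list ys /\<^sub>R real m)
      \<le> \<rho> * d * real m powr (- (1 - 1 / p)) * (\<Sum>i<k. (2 powr (- (1 - 1 / p))) ^ i)"
  using xs
proof (induction k arbitrary: xs)
  case 0
  then show ?case by (intro exI[of _ xs]) auto
next
  case (Suc k)
  let ?u = "1 - 1 / p"
  have u: "0 < ?u" using p by simp
  have d: "0 \<le> d" using E(2)[OF E(1)] by simp
  obtain ys where ys: "length ys = 2 ^ k * m" "set ys \<subseteq> E"
    "norm (sum_list xs /\<^sub>R real (2 * (2 ^ k * m)) - sum_list ys /\<^sub>R real (2 ^ k * m))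
      \<le> \<rho> * d * real (2 * (2 ^ k * m)) powr (- ?u)"
    using halve_average[OF signs \<rho> p, of xs "2 ^ k * m" E d] Suc.prems m E by auto
  obtain zs where zs: "length zs = m" "set zs \<subseteq> E"
    "norm (sum_list ys /\<^sub>R real (2 ^ k * m) - sum_list zs /\<^sub>R real m)
      \<le> \<rho> * d * real m powr (- ?u) * (\<Sum>i<k. (2 powr (- ?u)) ^ i)"
    using Suc.IH[OF ys(1,2)] by blast
  have "norm (sum_list xs /\<^sub>R real (2 ^ Suc k * m) - sum_list zs /\<^sub>R real m)
      \<le> norm (sum_list xs /\<^sub>R real (2 ^ Suc k * m) - sum_list ys /\<^sub>R real (2 ^ k * m))
        + norm (sum_list ys /\<^sub>R real (2 ^ k * m) - sum_list zs /\<^sub>R real m)"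
    by (rule norm_diff_via)
  also have "\<dots> \<le> \<rho> * d * real (2 * (2 ^ k * m)) powr (- ?u)
      + \<rho> * d * real m powr (- ?u) * (\<Sum>i<k. (2 powr (- ?u)) ^ i)"
    using ys(3) zs(3) by (intro add_mono) (simp_all only: power_Suc mult.assoc)
  also have "\<dots> \<le> \<rho> * d * (real m powr (- ?u) * (2 powr (- ?u)) ^ k)
      + \<rho> * d * real m powr (- ?u) * (\<Sum>i<k. (2 powr (- ?u)) ^ i)"
  proof -
    have "real (2 * (2 ^ k * m)) powr (- ?u) \<le> real (2 ^ k * m) powr (- ?u)"
      using m u by (intro powr_mono2') auto
    also have "\<dots> = real m powr (- ?u) * (2 powr (- ?u)) ^ k"
      by (simp add: powr_mult powr_powr powr_realpow[symmetric] mult.commute)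
    finally show ?thesis
      using \<rho> d by (intro add_right_mono mult_left_mono) auto
  qed
  also have "\<dots> = \<rho> * d * real m powr (- ?u) * (\<Sum>i<Suc k. (2 powr (- ?u)) ^ i)"
    by (simp add: algebra_simps)
  finally have "norm (sum_list xs /\<^sub>R real (2 ^ Suc k * m) - sum_list zs /\<^sub>R real m)
      \<le> \<rho> * d * real m powr (- ?u) * (\<Sum>i<Suc k. (2 powr (- ?u)) ^ i)" .
  then show ?case using zs by blast
qed

text \<open>Each coefficient is rounded towards zero to a multiple of \<open>1 / M\<close> and its sign is absorbed into the
  point, at an error of at most \<open>d / M\<close> per point of \<open>D\<close>.\<close>

lemma average_approximation:
  fixes D :: "'a::real_normed_vector set"
  assumes "finite D" "0 < M" "\<And>x. x \<in> D \<Longrightarrow> norm x \<le> d"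
  shows "\<exists>xs. real (length xs) \<le> real M * (\<Sum>x\<in>D. \<bar>t x\<bar>) \<and> set xs \<subseteq> D \<union> uminus ` D \<and>
    norm ((\<Sum>x\<in>D. t x *\<^sub>R x) - sum_list xs /\<^sub>R real M) \<le> real (card D) * d / real M"
  using assms(1,3)
proof (induction D rule: finite_induct)
  case empty
  then show ?case by (intro exI[of _ "[]"]) auto
next
  case (insert a D)
  obtain xs where xs: "real (length xs) \<le> real M * (\<Sum>x\<in>D. \<bar>t x\<bar>)" "set xs \<subseteq> D \<union> uminus ` D"
    "norm ((\<Sum>x\<in>D. t x *\<^sub>R x) - sum_list xs /\<^sub>R real M) \<le> real (card D) * d / real M"
    using insert by auto
  define n where "n = nat \<lfloor>real M * \<bar>t a\<bar>\<rfloor>"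
  have n: "real n \<le> real M * \<bar>t a\<bar>" "real M * \<bar>t a\<bar> < real n + 1"
    by (auto simp: n_def)
  define b where "b = (if 0 \<le> t a then a else - a)"
  have tb: "t a *\<^sub>R a = \<bar>t a\<bar> *\<^sub>R b" "norm b = norm a" by (auto simp: b_def)
  have d: "norm a \<le> d" using insert.prems by simp
  have "norm (t a *\<^sub>R a - (real n *\<^sub>R b) /\<^sub>R real M) \<le> d / real M"
  proof -
    have "(real M * \<bar>t a\<bar> - real n) / real M = \<bar>t a\<bar> - inverse (real M) * real n"
      using assms(2) by (simp add: field_simps)
    then have "t a *\<^sub>R a - (real n *\<^sub>R b) /\<^sub>R real M = ((real M * \<bar>t a\<bar> - real n) / real M) *\<^sub>R b"
      by (simp only: tb scaleR_diff_left scaleR_scaleR)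
    then have "norm (t a *\<^sub>R a - (real n *\<^sub>R b) /\<^sub>R real M)
        = (real M * \<bar>t a\<bar> - real n) / real M * norm a"
      using n(1) by (simp add: tb)
    also have "\<dots> \<le> 1 / real M * d"
      using n d assms(2) by (intro mult_mono divide_right_mono) auto
    finally show ?thesis by simp
  qed
  then have "norm ((t a *\<^sub>R a - (real n *\<^sub>R b) /\<^sub>R real M)
      + ((\<Sum>x\<in>D. t x *\<^sub>R x) - sum_list xs /\<^sub>R real M)) \<le> d / real M + real (card D) * d / real M"
    using xs(3) by (intro norm_triangle_mono)
  moreover have "(t a *\<^sub>R a - (real n *\<^sub>R b) /\<^sub>R real M) + ((\<Sum>x\<in>D. t x *\<^sub>R x) - sum_list xs /\<^sub>R real M)
      = (\<Sum>x\<in>insert a D. t x *\<^sub>R x) - sum_list (replicate n b @ xs) /\<^sub>R real M"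
    using insert.hyps by (simp add: sum_list_replicate_scaleR scaleR_add_right)
  moreover have "d / real M + real (card D) * d / real M = real (card (insert a D)) * d / real M"
    using insert.hyps by (simp add: field_simps add_divide_distrib)
  moreover have "real (length (replicate n b @ xs)) \<le> real M * (\<Sum>x\<in>insert a D. \<bar>t x\<bar>)"
    using insert.hyps n xs by (simp add: algebra_simps)
  moreover have "set (replicate n b @ xs) \<subseteq> insert a D \<union> uminus ` insert a D"
    using xs(2) by (auto simp: b_def)
  ultimately show ?case
    by (intro exI[of _ "replicate n b @ xs"] conjI) (simp_all only:)
qed

text \<open>A combination of points of \<open>D\<close> is first rounded to an average of \<open>2 ^ k * m\<close> points, with \<open>k\<close> so large that
  the rounding error is at most \<open>d / m\<close>, and then shortened to \<open>m\<close> points. The centres of the balls are the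
  averages of \<open>m\<close> points of \<open>D \<union> -D \<union> {0}\<close>, which number at most \<open>(2 |D| + 1) ^ m\<close>.\<close>

lemma maurey_covers:
  fixes D :: "'a::real_normed_vector set"
  assumes signs: "sign_type TYPE('a) p \<rho>"
    and \<rho>: "0 < \<rho>" and p: "1 < p"
    and D: "finite D" "\<And>x. x \<in> D \<Longrightarrow> norm x \<le> d" and d: "0 \<le> d" and m: "1 \<le> m"
  shows "covers ((2 * card D + 1) ^ m)
    ((1 + \<rho> / (1 - 2 powr (- (1 - 1 / p)))) * d * real m powr (- (1 - 1 / p)))
    (absolutely_convex hull D)"
proof -
  let ?u = "1 - 1 / p"
  let ?q = "2 powr (- ?u) :: real"
  have u: "0 < ?u" "?u < 1" using p by auto
  have q: "0 < ?q" "?q < 1" using u by (auto intro: powr_less_one)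
  let ?E = "insert 0 (D \<union> uminus ` D)"
  let ?L = "{ys. set ys \<subseteq> ?E \<and> length ys = m}"
  let ?C = "(\<lambda>ys. sum_list ys /\<^sub>R real m) ` ?L"
  let ?r = "(1 + \<rho> / (1 - ?q)) * d * real m powr (- ?u)"
  have E: "finite ?E" "\<And>z. z \<in> ?E \<Longrightarrow> norm z \<le> d" using D d by auto
  have "card ?E \<le> Suc (card (D \<union> uminus ` D))"
    by (rule card_insert_le_m1) auto
  also have "\<dots> \<le> Suc (card D + card (uminus ` D))"
    using card_Un_le by (rule Suc_leI[OF le_imp_less_Suc])
  also have "\<dots> \<le> 2 * card D + 1"
    using card_image_le[OF D(1), of uminus] by simp
  finally have card_E: "card ?E \<le> 2 * card D + 1" .
  have "card ?C \<le> card ?L"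
    using E(1) by (intro card_image_le finite_lists_length_eq)
  also have "\<dots> = card ?E ^ m"
    using E(1) by (rule card_lists_length_eq)
  also have "\<dots> \<le> (2 * card D + 1) ^ m"
    using card_E by (rule power_mono) simp
  finally have card: "card ?C \<le> (2 * card D + 1) ^ m" .
  have "absolutely_convex hull D \<subseteq> (\<Union>c\<in>?C. cball c ?r)"
  proof
    fix y assume "y \<in> absolutely_convex hull D"
    then obtain t where t: "y = (\<Sum>x\<in>D. t x *\<^sub>R x)" "(\<Sum>x\<in>D. \<bar>t x\<bar>) \<le> 1"
      using absolutely_convex_hull_finite_subset[OF D(1)] by blast
    define k where "k = card D"
    define M where "M = 2 ^ k * m"
    have M: "0 < M" using m by (simp add: M_def)
    obtain xs where xs: "real (length xs) \<le> real M * (\<Sum>x\<in>D. \<bar>t x\<bar>)" "set xs \<subseteq> D \<union> uminus ` D"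
      "norm (y - sum_list xs /\<^sub>R real M) \<le> real (card D) * d / real M"
      using average_approximation[OF D(1) M D(2), of t] t(1) by blast
    have "real (length xs) \<le> real M"
      using xs(1) mult_left_mono[OF t(2), of "real M"] by simp
    then have len: "length xs \<le> M" by simp
    let ?xs = "xs @ replicate (M - length xs) 0"
    have "length ?xs = 2 ^ k * m" "set ?xs \<subseteq> ?E"
      using len xs(2) by (auto simp: M_def)
    from shorten_average[OF signs \<rho> p this m _ E(2)]
    obtain ys where ys: "length ys = m" "set ys \<subseteq> ?E"
      "norm (sum_list ?xs /\<^sub>R real M - sum_list ys /\<^sub>R real m)
        \<le> \<rho> * d * real m powr (- ?u) * (\<Sum>i<k. ?q ^ i)"
      unfolding M_def by blast
    have "real (card D) * d / real M \<le> d * real m powr (- ?u)"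
    proof -
      have "real (card D) \<le> 2 ^ k"
        unfolding k_def using of_nat_less_two_power less_imp_le by blast
      then have "real (card D) * d / real M \<le> 2 ^ k * d / real M"
        using d by (intro divide_right_mono mult_right_mono) auto
      also have "\<dots> = d * real m powr (- 1)"
        using m by (simp add: M_def powr_minus divide_simps)
      also have "\<dots> \<le> d * real m powr (- ?u)"
        using d m u by (intro mult_left_mono powr_mono) auto
      finally show ?thesis .
    qed
    moreover have "\<rho> * d * real m powr (- ?u) * (\<Sum>i<k. ?q ^ i)
        \<le> \<rho> * d * real m powr (- ?u) * (1 / (1 - ?q))"
      using \<rho> d geometric_sum_le[OF q] by (intro mult_left_mono) auto
    moreover have "norm (y - sum_list ys /\<^sub>R real m)
        \<le> norm (y - sum_list xs /\<^sub>R real M) + norm (sum_list ?xs /\<^sub>R real M - sum_list ys /\<^sub>R real m)"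
      using norm_diff_via[of y "sum_list ys /\<^sub>R real m" "sum_list xs /\<^sub>R real M"]
      by (simp add: sum_list_replicate_scaleR)
    ultimately have "norm (y - sum_list ys /\<^sub>R real m)
        \<le> d * real m powr (- ?u) + \<rho> * d * real m powr (- ?u) * (1 / (1 - ?q))"
      using xs(3) ys(3) by linarith
    also have "\<dots> = ?r" by (simp add: algebra_simps)
    finally have "y \<in> cball (sum_list ys /\<^sub>R real m) ?r"
      by (simp add: dist_norm norm_minus_commute)
    then show "y \<in> (\<Union>c\<in>?C. cball c ?r)" using ys by blast
  qed
  moreover have "finite ?C"
    using E(1) by (intro finite_imageI finite_lists_length_eq)
  ultimately show ?thesis
    unfolding covers_def using card by blast
qed

section \<open>Chaining\<close>

text \<open>The maps \<open>\<pi> j\<close> are successive approximations of the points of \<open>A\<close>; their increments lie in the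
  absolutely convex sets \<open>B j\<close>, so the last approximation lies in the Minkowski sum of all these sets.\<close>

lemma chaining_covers:
  fixes B :: "nat \<Rightarrow> 'a::real_normed_vector set" and \<pi> :: "nat \<Rightarrow> 'a \<Rightarrow> 'a"
  assumes B: "\<And>j. j \<le> J \<Longrightarrow> absolutely_convex (B j)" "\<And>j. j \<le> J \<Longrightarrow> covers (2 ^ n j) (r j) (B j)"
    and \<pi>: "\<And>x. x \<in> A \<Longrightarrow> \<pi> 0 x \<in> B 0"
      "\<And>j x. j < J \<Longrightarrow> x \<in> A \<Longrightarrow> \<pi> (Suc j) x - \<pi> j x \<in> B (Suc j)"
  shows "\<exists>T. absolutely_convex T \<and> covers (2 ^ (\<Sum>j\<le>J. n j)) (\<Sum>j\<le>J. r j) T \<and> \<pi> J ` A \<subseteq> T"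
  using assms
proof (induction J)
  case 0
  then show ?case by (intro exI[of _ "B 0"]) auto
next
  case (Suc J)
  have "\<exists>T. absolutely_convex T \<and> covers (2 ^ (\<Sum>j\<le>J. n j)) (\<Sum>j\<le>J. r j) T \<and> \<pi> J ` A \<subseteq> T"
    by (rule Suc.IH) (use Suc.prems in auto)
  then obtain T where T: "absolutely_convex T" "covers (2 ^ (\<Sum>j\<le>J. n j)) (\<Sum>j\<le>J. r j) T" "\<pi> J ` A \<subseteq> T"
    by (elim exE conjE)
  have "\<pi> (Suc J) x \<in> T + B (Suc J)" if "x \<in> A" for x
  proof -
    have "\<pi> J x + (\<pi> (Suc J) x - \<pi> J x) \<in> T + B (Suc J)"
      using T(3) Suc.prems(4)[OF _ that, of J] that by (intro set_plus_intro) auto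
    then show ?thesis by simp
  qed
  moreover have "absolutely_convex (T + B (Suc J))"
    using T(1) Suc.prems(1)[of "Suc J"] by (intro absolutely_convex_plus) auto
  moreover have "covers (2 ^ (\<Sum>j\<le>Suc J. n j)) (\<Sum>j\<le>Suc J. r j) (T + B (Suc J))"
    using covers_plus[OF T(2) Suc.prems(2)[OF order_refl]] by (simp add: power_add mult.commute)
  ultimately show ?case by blast
qed

lemma difference_net_card:
  assumes "finite C" "card C \<le> 2 ^ (2 ^ j)" "finite C'" "card C' \<le> 2 ^ (2 ^ Suc j)"
  shows "card ((\<lambda>(c, d). d - c) ` (C \<times> C')) \<le> 2 ^ (2 ^ Suc (Suc j))"
proof -
  have "card ((\<lambda>(c, d). d - c) ` (C \<times> C')) \<le> card C * card C'"
    using assms by (metis card_cartesian_product card_image_le finite_cartesian_product)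
  also have "\<dots> \<le> 2 ^ (2 ^ j) * 2 ^ (2 ^ Suc j)"
    using assms by (intro mult_le_mono) auto
  also have "\<dots> = 2 ^ (2 ^ j + 2 ^ Suc j)" by (rule power_add[symmetric])
  also have "\<dots> \<le> 2 ^ (2 ^ Suc (Suc j))"
    by (intro power_increasing) auto
  finally show ?thesis .
qed

text \<open>The map \<open>\<pi> j\<close> sends a point to a nearby centre of the net of level \<open>j\<close>, and \<open>D j\<close> collects the
  increments, with \<open>\<pi> 0\<close> itself as the increment of level \<open>0\<close>. Consecutive radii differ by the factor
  \<open>2 powr \<beta> \<le> 2\<close>, whence the bound \<open>S (1 + 2 powr \<beta>) \<le> 4 S\<close> on the scale of level \<open>j\<close>.\<close>

lemma difference_nets:
  fixes A :: "'a::real_normed_vector set"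
  assumes S: "0 < S" and \<beta>: "0 < \<beta>" "\<beta> \<le> 1"
    and A: "\<And>x. x \<in> A \<Longrightarrow> norm x \<le> S"
    and cov: "\<And>j. j \<le> J \<Longrightarrow> covers (2 ^ (2 ^ j)) (S * 2 powr (- \<beta> * j)) A"
  obtains \<pi> :: "nat \<Rightarrow> 'a \<Rightarrow> 'a" and D :: "nat \<Rightarrow> 'a set" where
    "\<And>x. x \<in> A \<Longrightarrow> norm (x - \<pi> J x) \<le> S * 2 powr (- \<beta> * J)"
    "\<And>x. x \<in> A \<Longrightarrow> \<pi> 0 x \<in> D 0"
    "\<And>j x. j < J \<Longrightarrow> x \<in> A \<Longrightarrow> \<pi> (Suc j) x - \<pi> j x \<in> D (Suc j)"
    "\<And>j. j \<le> J \<Longrightarrow> finite (D j)"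
    "\<And>j. j \<le> J \<Longrightarrow> card (D j) \<le> 2 ^ (2 ^ Suc j)"
    "\<And>j z. j \<le> J \<Longrightarrow> z \<in> D j \<Longrightarrow> norm z \<le> 4 * S * 2 powr (- \<beta> * j)"
proof -
  have "\<exists>C. finite C \<and> card C \<le> 2 ^ (2 ^ j) \<and> (\<forall>x\<in>A. \<exists>c\<in>C. dist c x \<le> S * 2 powr (- \<beta> * j))"
    if "j \<le> J" for j
    using cov[OF that] unfolding covers_def subset_iff UN_iff mem_cball by (elim exE conjE) blast
  then have "\<forall>j. \<exists>C. j \<le> J \<longrightarrow> finite C \<and> card C \<le> 2 ^ (2 ^ j) \<and>
      (\<forall>x\<in>A. \<exists>c\<in>C. dist c x \<le> S * 2 powr (- \<beta> * j))" by blast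
  from choice[OF this] obtain C where
    C: "\<And>j. j \<le> J \<Longrightarrow> finite (C j)" "\<And>j. j \<le> J \<Longrightarrow> card (C j) \<le> 2 ^ (2 ^ j)"
      "\<And>j x. j \<le> J \<Longrightarrow> x \<in> A \<Longrightarrow> \<exists>c\<in>C j. dist c x \<le> S * 2 powr (- \<beta> * j)"
    by (auto simp del: One_nat_def)
  define \<pi> where "\<pi> j x = (SOME c. c \<in> C j \<and> dist c x \<le> S * 2 powr (- \<beta> * j))" for j x
  have \<pi>: "\<pi> j x \<in> C j" "dist (\<pi> j x) x \<le> S * 2 powr (- \<beta> * j)" if "j \<le> J" "x \<in> A" for j x
  proof -
    have "\<exists>c. c \<in> C j \<and> dist c x \<le> S * 2 powr (- \<beta> * j)"
      using C(3)[OF that] by blast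
    from someI_ex[OF this] show "\<pi> j x \<in> C j" "dist (\<pi> j x) x \<le> S * 2 powr (- \<beta> * j)"
      unfolding \<pi>_def by auto
  qed
  define D where "D j = (case j of 0 \<Rightarrow> \<pi> 0 ` A | Suc i \<Rightarrow> (\<lambda>x. \<pi> (Suc i) x - \<pi> i x) ` A)" for j
  have D_Suc_sub: "D (Suc i) \<subseteq> (\<lambda>(c, d). d - c) ` (C i \<times> C (Suc i))" if "Suc i \<le> J" for i
  proof
    fix z assume "z \<in> D (Suc i)"
    then obtain x where x: "x \<in> A" "z = \<pi> (Suc i) x - \<pi> i x" by (auto simp: D_def)
    then show "z \<in> (\<lambda>(c, d). d - c) ` (C i \<times> C (Suc i))"
      using \<pi>(1)[OF that x(1)] \<pi>(1)[of i, OF _ x(1)] that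
      by (intro image_eqI[of _ _ "(\<pi> i x, \<pi> (Suc i) x)"]) auto
  qed
  have D_0_sub: "D 0 \<subseteq> C 0" using \<pi>(1)[of 0] by (auto simp: D_def)
  show ?thesis
  proof (rule that)
    show "norm (x - \<pi> J x) \<le> S * 2 powr (- \<beta> * J)" if "x \<in> A" for x
      using \<pi>(2)[OF order_refl that] by (simp add: dist_norm norm_minus_commute)
    show "\<pi> 0 x \<in> D 0" if "x \<in> A" for x using that by (simp add: D_def)
    show "\<pi> (Suc j) x - \<pi> j x \<in> D (Suc j)" if "j < J" "x \<in> A" for j x
      using that by (simp add: D_def)
    show "finite (D j)" if "j \<le> J" for j
    proof (cases j)
      case 0
      then show ?thesis using D_0_sub C(1)[of 0] finite_subset by auto
    next
      case (Suc i)
      have "finite ((\<lambda>(c, d). d - c) ` (C i \<times> C (Suc i)))"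
        using C(1) that Suc by (intro finite_imageI finite_cartesian_product) auto
      then show ?thesis unfolding Suc using D_Suc_sub that Suc by (meson finite_subset)
    qed
    show "card (D j) \<le> 2 ^ (2 ^ Suc j)" if "j \<le> J" for j
    proof (cases j)
      case 0
      have "card (D 0) \<le> card (C 0)" using D_0_sub C(1)[of 0] by (intro card_mono) auto
      also have "\<dots> \<le> 2" using C(2)[of 0] by simp
      finally show ?thesis using 0 by simp
    next
      case (Suc i)
      have "card (D (Suc i)) \<le> card ((\<lambda>(c, d). d - c) ` (C i \<times> C (Suc i)))"
        using C(1) that Suc D_Suc_sub[of i]
        by (intro card_mono finite_imageI finite_cartesian_product) auto
      also have "\<dots> \<le> 2 ^ (2 ^ Suc (Suc i))"
        using that Suc by (intro difference_net_card C) auto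
      finally show ?thesis unfolding Suc .
    qed
    show "norm z \<le> 4 * S * 2 powr (- \<beta> * j)" if j: "j \<le> J" and z: "z \<in> D j" for j z
    proof (cases j)
      case 0
      then obtain x where x: "x \<in> A" "z = \<pi> 0 x" using z by (auto simp: D_def)
      have "norm z \<le> norm (\<pi> 0 x - x) + norm x"
        unfolding x(2) using norm_diff_via[of "\<pi> 0 x" 0 x] by simp
      also have "\<dots> \<le> S + S"
        using \<pi>(2)[of 0 x] x A by (intro add_mono) (auto simp: dist_norm)
      finally show ?thesis using 0 S by simp
    next
      case (Suc i)
      then obtain x where x: "x \<in> A" "z = \<pi> (Suc i) x - \<pi> i x" using z by (auto simp: D_def)
      have "norm z \<le> dist (\<pi> (Suc i) x) x + dist (\<pi> i x) x"
        unfolding x(2) dist_norm[symmetric] by (rule dist_triangle2)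
      also have "\<dots> \<le> S * 2 powr (- \<beta> * Suc i) + S * 2 powr (- \<beta> * i)"
        using \<pi>(2)[of "Suc i" x] \<pi>(2)[of i x] x(1) j Suc by (intro add_mono) simp_all
      also have "2 powr (- \<beta> * i) = 2 powr \<beta> * 2 powr (- \<beta> * Suc i)"
        by (simp add: powr_add[symmetric] algebra_simps)
      also have "S * 2 powr (- \<beta> * Suc i) + S * (2 powr \<beta> * 2 powr (- \<beta> * Suc i))
          = (1 + 2 powr \<beta>) * (S * 2 powr (- \<beta> * Suc i))"
        by (simp add: algebra_simps)
      also have "\<dots> \<le> 4 * (S * 2 powr (- \<beta> * Suc i))"
      proof (rule mult_right_mono)
        have "2 powr \<beta> \<le> 2 powr 1" using \<beta> by (intro powr_mono) auto
        then show "1 + 2 powr \<beta> \<le> (4 :: real)" by simp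
      qed (use S in simp)
      finally show ?thesis unfolding Suc by (simp add: mult.assoc)
    qed
  qed
qed

lemma geometric_sum_reversed_le:
  fixes c :: real
  assumes "0 < c"
  shows "(\<Sum>j\<le>J. 2 powr (- c * (real J - real j))) \<le> 1 / (1 - 2 powr (- c))"
proof -
  have "(\<Sum>j\<le>J. 2 powr (- c * (real J - real j))) = (\<Sum>i<Suc J. (2 powr (- c)) ^ i)"
    by (rule sum.reindex_bij_witness[of _ "\<lambda>i. J - i" "\<lambda>i. J - i"])
       (auto simp: powr_realpow[symmetric] powr_powr of_nat_diff)
  also have "\<dots> \<le> 1 / (1 - 2 powr (- c))"
    using assms by (intro geometric_sum_le) (auto intro: powr_less_one)
  finally show ?thesis .
qed

text \<open>Level \<open>j\<close> costs \<open>m j * 2 ^ (j + 2)\<close> binary digits for the centres, by Maurey's lemma with \<open>m j\<close> points taken from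
  a set of at most \<open>2 ^ 2 ^ (j + 1)\<close> increments. With \<open>m j\<close> about \<open>2 powr (\<tau> * (J - j))\<close> both the costs and the
  errors are dominated by geometric series in \<open>J - j\<close>: the costs sum to a multiple of \<open>2 ^ J\<close>, as \<open>\<tau> < 1\<close>, and
  the errors to a multiple of \<open>S * 2 powr (- \<beta> * J)\<close>, as \<open>\<tau> u > \<beta>\<close>.\<close>

lemma absolutely_convex_hull_covers:
  assumes signs: "sign_type TYPE('a::real_normed_vector) p \<rho>"
    and \<rho>: "0 < \<rho>" and p: "1 < p" and \<beta>: "0 < \<beta>" "\<beta> < 1 - 1 / p"
  obtains K :: nat and C :: real where "1 \<le> K" "0 < C"
    "\<And>(A :: 'a set) S J. 0 < S \<Longrightarrow> (\<And>x. x \<in> A \<Longrightarrow> norm x \<le> S) \<Longrightarrow>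
      (\<And>j. j \<le> J \<Longrightarrow> covers (2 ^ (2 ^ j)) (S * 2 powr (- \<beta> * j)) A) \<Longrightarrow>
      covers (2 ^ (K * 2 ^ J)) (C * S * 2 powr (- \<beta> * J)) (absolutely_convex hull A)"
proof -
  define u where "u = 1 - 1 / p"
  have u: "0 < u" "u < 1" "\<beta> < u" using p \<beta> by (auto simp: u_def)
  \<comment> \<open>The midpoint between \<open>\<beta> / u\<close> and \<open>1\<close>.\<close>
  define \<tau> where "\<tau> = (\<beta> / u + 1) / 2"
  have \<tau>: "0 < \<tau>" "\<tau> < 1" "\<beta> < \<tau> * u" using u \<beta> by (auto simp: \<tau>_def field_simps)
  define G where "G = 1 + \<rho> / (1 - 2 powr (- u))"
  have G: "0 < G"
  proof -
    have "2 powr (- u) < 1" using u by (auto intro: powr_less_one)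
    then show ?thesis using \<rho> by (simp add: G_def add_pos_pos)
  qed
  define Q where "Q = 1 / (1 - 2 powr (- (\<tau> * u - \<beta>)))"
  have Q: "0 < Q"
    using \<tau>(3) powr_less_one[of 2 "- (\<tau> * u - \<beta>)"] by (simp add: Q_def)
  define K where "K = nat \<lceil>8 * (1 / (1 - 2 powr (- (1 - \<tau>))))\<rceil>"
  have K: "8 * (1 / (1 - 2 powr (- (1 - \<tau>)))) \<le> real K" "1 \<le> K"
  proof -
    show K': "8 * (1 / (1 - 2 powr (- (1 - \<tau>)))) \<le> real K"
      unfolding K_def by (rule real_nat_ceiling_ge)
    have "2 powr (- (1 - \<tau>)) < (1 :: real)" using \<tau> by (auto intro: powr_less_one)
    then have "0 < 8 * (1 / (1 - 2 powr (- (1 - \<tau>))))" by simp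
    then have "0 < real K" using K' by linarith
    then show "1 \<le> K" by simp
  qed
  define Cc where "Cc = 4 * G * Q + 1"
  have "covers (2 ^ (K * 2 ^ J)) (Cc * S * 2 powr (- \<beta> * J)) (absolutely_convex hull A)"
    if S: "0 < S" and A: "\<And>x. x \<in> A \<Longrightarrow> norm x \<le> S"
      and cov: "\<And>j. j \<le> J \<Longrightarrow> covers (2 ^ (2 ^ j)) (S * 2 powr (- \<beta> * j)) A"
    for A :: "'a set" and S :: real and J :: nat
  proof -
    have "\<beta> \<le> 1" using u by simp
    obtain \<pi> :: "nat \<Rightarrow> 'a \<Rightarrow> 'a" and D :: "nat \<Rightarrow> 'a set" where
      \<pi>: "\<And>x. x \<in> A \<Longrightarrow> norm (x - \<pi> J x) \<le> S * 2 powr (- \<beta> * J)"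
        "\<And>x. x \<in> A \<Longrightarrow> \<pi> 0 x \<in> D 0"
        "\<And>j x. j < J \<Longrightarrow> x \<in> A \<Longrightarrow> \<pi> (Suc j) x - \<pi> j x \<in> D (Suc j)"
      and D: "\<And>j. j \<le> J \<Longrightarrow> finite (D j)" "\<And>j. j \<le> J \<Longrightarrow> card (D j) \<le> 2 ^ (2 ^ Suc j)"
        "\<And>j z. j \<le> J \<Longrightarrow> z \<in> D j \<Longrightarrow> norm z \<le> 4 * S * 2 powr (- \<beta> * j)"
      using difference_nets[OF S \<beta>(1) \<open>\<beta> \<le> 1\<close> A cov] by blast
    define m where "m j = nat \<lceil>2 powr (\<tau> * (real J - real j))\<rceil>" for j
    have m: "2 powr (\<tau> * (real J - real j)) \<le> real (m j)" "1 \<le> m j"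
      "real (m j) \<le> 2 * 2 powr (\<tau> * (real J - real j))" if "j \<le> J" for j
    proof -
      show 1: "2 powr (\<tau> * (real J - real j)) \<le> real (m j)"
        unfolding m_def by (rule real_nat_ceiling_ge)
      have 2: "1 \<le> 2 powr (\<tau> * (real J - real j))"
        using \<tau> that by (intro ge_one_powr_ge_zero) auto
      show "1 \<le> m j" using 1 2 by linarith
      have "real (m j) \<le> 2 powr (\<tau> * (real J - real j)) + 1"
        unfolding m_def using 2 by linarith
      then show "real (m j) \<le> 2 * 2 powr (\<tau> * (real J - real j))" using 2 by linarith
    qed
    have D_cov: "covers (2 ^ (m j * 2 ^ (j + 2)))
        (4 * G * S * 2 powr (- \<beta> * J) * 2 powr (- (\<tau> * u - \<beta>) * (real J - real j)))
        (absolutely_convex hull D j)" if j: "j \<le> J" for j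
    proof (rule covers_mono[OF maurey_covers[OF signs \<rho> p D(1)[OF j] D(3)[OF j] _ m(2)[OF j]] order_refl])
      have "2 * card (D j) + 1 \<le> 2 * 2 ^ (2 ^ Suc j) + 2 * 2 ^ (2 ^ Suc j)"
        using D(2)[OF j] by (intro add_mono mult_le_mono) auto
      also have "\<dots> = 2 ^ (2 ^ Suc j + 2)" by (simp add: power_add)
      also have "\<dots> \<le> 2 ^ (2 ^ (j + 2))" 
      proof (rule power_increasing)
        have "(2::nat) \<le> 2 ^ Suc j" by simp
        then show "2 ^ Suc j + 2 \<le> (2::nat) ^ (j + 2)" by (simp add: power_add)
      qed simp
      finally have "(2 * card (D j) + 1) ^ m j \<le> (2 ^ (2 ^ (j + 2))) ^ m j"
        by (rule power_mono) simp
      then show "(2 * card (D j) + 1) ^ m j \<le> 2 ^ (m j * 2 ^ (j + 2))"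
        by (simp only: power_mult[symmetric] mult.commute)
      have "real (m j) powr (- u) \<le> (2 powr (\<tau> * (real J - real j))) powr (- u)"
        using m(1)[OF j] u by (intro powr_mono2') auto
      also have "\<dots> = 2 powr (- \<tau> * u * (real J - real j))"
        by (simp add: powr_powr algebra_simps)
      finally have "G * (4 * S * 2 powr (- \<beta> * j)) * real (m j) powr (- u)
          \<le> G * (4 * S * 2 powr (- \<beta> * j)) * 2 powr (- \<tau> * u * (real J - real j))"
        using G S by (intro mult_left_mono) auto
      also have "\<dots> = 4 * G * S * (2 powr (- \<beta> * j) * 2 powr (- \<tau> * u * (real J - real j)))"
        by simp
      also have "2 powr (- \<beta> * j) * 2 powr (- \<tau> * u * (real J - real j))
          = 2 powr (- \<beta> * J) * 2 powr (- (\<tau> * u - \<beta>) * (real J - real j))"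
        by (simp add: powr_add[symmetric] algebra_simps)
      finally show "(1 + \<rho> / (1 - 2 powr (- (1 - 1 / p)))) * (4 * S * 2 powr (- \<beta> * j)) * real (m j) powr (- (1 - 1 / p))
          \<le> 4 * G * S * 2 powr (- \<beta> * J) * 2 powr (- (\<tau> * u - \<beta>) * (real J - real j))"
        unfolding G_def u_def by (simp only: mult.assoc)
    qed (use S in simp_all)
    have "\<exists>T. absolutely_convex T \<and> covers (2 ^ (\<Sum>j\<le>J. m j * 2 ^ (j + 2)))
        (\<Sum>j\<le>J. 4 * G * S * 2 powr (- \<beta> * J) * 2 powr (- (\<tau> * u - \<beta>) * (real J - real j))) T \<and> \<pi> J ` A \<subseteq> T"
    proof (rule chaining_covers[where B = "\<lambda>j. absolutely_convex hull D j"])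
      show "\<pi> 0 x \<in> absolutely_convex hull D 0" if "x \<in> A" for x
        using \<pi>(2)[OF that] by (rule hull_inc)
      show "\<pi> (Suc j) x - \<pi> j x \<in> absolutely_convex hull D (Suc j)" if "j < J" "x \<in> A" for j x
        using \<pi>(3)[OF that] by (rule hull_inc)
    qed (use D_cov absolutely_convex_hull in auto)
    then obtain T where T: "absolutely_convex T" "\<pi> J ` A \<subseteq> T" "covers (2 ^ (\<Sum>j\<le>J. m j * 2 ^ (j + 2)))
        (\<Sum>j\<le>J. 4 * G * S * 2 powr (- \<beta> * J) * 2 powr (- (\<tau> * u - \<beta>) * (real J - real j))) T"
      by blast
    have "real (\<Sum>j\<le>J. m j * 2 ^ (j + 2)) \<le> real (K * 2 ^ J)"
    proof -
      have "real (\<Sum>j\<le>J. m j * 2 ^ (j + 2)) = (\<Sum>j\<le>J. real (m j) * (4 * 2 powr real j))"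
        by (simp add: powr_realpow mult_ac)
      also have "\<dots> \<le> (\<Sum>j\<le>J. 2 * 2 powr (\<tau> * (real J - real j)) * (4 * 2 powr real j))"
        using m(3) by (intro sum_mono mult_right_mono) auto
      also have "\<dots> = (\<Sum>j\<le>J. 8 * 2 ^ J * 2 powr (- (1 - \<tau>) * (real J - real j)))"
      proof (rule sum.cong)
        fix j
        have "2 powr (\<tau> * (real J - real j)) * 2 powr real j
            = 2 powr real J * 2 powr (- (1 - \<tau>) * (real J - real j))"
          by (simp add: powr_add[symmetric] algebra_simps)
        then show "2 * 2 powr (\<tau> * (real J - real j)) * (4 * 2 powr real j)
            = 8 * 2 ^ J * 2 powr (- (1 - \<tau>) * (real J - real j))"
          by (simp add: powr_realpow)
      qed simp
      also have "\<dots> = 2 ^ J * (8 * (\<Sum>j\<le>J. 2 powr (- (1 - \<tau>) * (real J - real j))))"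
        by (simp add: sum_distrib_left mult_ac)
      also have "\<dots> \<le> 2 ^ J * (8 * (1 / (1 - 2 powr (- (1 - \<tau>)))))"
        using \<tau> by (intro mult_left_mono geometric_sum_reversed_le) auto
      also have "\<dots> \<le> 2 ^ J * real K"
        using K by (intro mult_left_mono) auto
      finally show ?thesis by (simp add: mult.commute)
    qed
    then have "(\<Sum>j\<le>J. m j * 2 ^ (j + 2)) \<le> K * 2 ^ J" by (simp only: of_nat_le_iff)
    then have num: "2 ^ (\<Sum>j\<le>J. m j * 2 ^ (j + 2)) * 1 \<le> (2 :: nat) ^ (K * 2 ^ J)"
      by (simp only: mult_1_right) (rule power_increasing, auto)
    have "(\<Sum>j\<le>J. 4 * G * S * 2 powr (- \<beta> * J) * 2 powr (- (\<tau> * u - \<beta>) * (real J - real j)))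
        = 4 * G * S * 2 powr (- \<beta> * J) * (\<Sum>j\<le>J. 2 powr (- (\<tau> * u - \<beta>) * (real J - real j)))"
      by (simp only: sum_distrib_left)
    also have "\<dots> \<le> 4 * G * S * 2 powr (- \<beta> * J) * Q"
      unfolding Q_def using \<tau> G S by (intro mult_left_mono geometric_sum_reversed_le) auto
    finally have rad: "(\<Sum>j\<le>J. 4 * G * S * 2 powr (- \<beta> * J) * 2 powr (- (\<tau> * u - \<beta>) * (real J - real j)))
        + S * 2 powr (- \<beta> * J) \<le> Cc * S * 2 powr (- \<beta> * J)"
      by (simp add: Cc_def algebra_simps)
    have "A \<subseteq> T + cball 0 (S * 2 powr (- \<beta> * J))"
    proof
      fix x assume x: "x \<in> A"
      have "\<pi> J x + (x - \<pi> J x) \<in> T + cball 0 (S * 2 powr (- \<beta> * J))"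
        using T(2) x \<pi>(1)[OF x] by (intro set_plus_intro) auto
      then show "x \<in> T + cball 0 (S * 2 powr (- \<beta> * J))" by simp
    qed
    then have "absolutely_convex hull A \<subseteq> T + cball 0 (S * 2 powr (- \<beta> * J))"
      by (intro hull_minimal absolutely_convex_plus absolutely_convex_cball_0 T(1))
    then show ?thesis
      using covers_mono[OF covers_plus[OF T(3) covers_cball[OF order_refl]] _ num rad] by blast
  qed
  then show ?thesis
    using that[of K Cc] K(2) G Q unfolding Cc_def by (simp add: add_pos_pos)
qed

section \<open>Entropy numbers of the hull\<close>

text \<open>The covering result at the scale \<open>J\<close> with \<open>K 2 ^ J < n \<le> K 2 ^ (J + 1)\<close>, where \<open>2 ^ J\<close> and \<open>n\<close>
  are comparable. For \<open>n \<le> K\<close> the trivial bound by \<open>T\<close> suffices. The entropy numbers are infima, so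
  the coverings exist only for radii given by \<open>S > T\<close>; letting \<open>S\<close> tend to \<open>T\<close> yields the claim.\<close>

lemma entropy_absolutely_convex_hull:
  assumes signs: "sign_type TYPE('a::real_normed_vector) p \<rho>"
    and \<rho>: "0 < \<rho>" and p: "1 < p" and \<beta>: "0 < \<beta>" "\<beta> < 1 - 1 / p"
  obtains C :: real where "0 < C"
    "\<And>(A :: 'a set) T n. bounded A \<Longrightarrow> (\<And>x. x \<in> A \<Longrightarrow> norm x \<le> T) \<Longrightarrow>
      (\<And>k. 1 \<le> k \<Longrightarrow> k \<le> n \<Longrightarrow> real k powr \<beta> * dyadic_entropy_number k A \<le> T) \<Longrightarrow>
      0 \<le> T \<Longrightarrow> 1 \<le> n \<Longrightarrow>
      dyadic_entropy_number n (absolutely_convex hull A) \<le> C * T * real n powr (- \<beta>)"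
proof -
  obtain K :: nat and C :: real where K: "1 \<le> K" and C: "0 < C" and main:
    "\<And>(A :: 'a set) S J. 0 < S \<Longrightarrow> (\<And>x. x \<in> A \<Longrightarrow> norm x \<le> S) \<Longrightarrow>
      (\<And>j. j \<le> J \<Longrightarrow> covers (2 ^ (2 ^ j)) (S * 2 powr (- \<beta> * j)) A) \<Longrightarrow>
      covers (2 ^ (K * 2 ^ J)) (C * S * 2 powr (- \<beta> * J)) (absolutely_convex hull A)"
    using absolutely_convex_hull_covers[OF signs \<rho> p \<beta>] by blast
  define c where "c = (C + 1) * (2 * real K) powr \<beta>"
  have bound: "dyadic_entropy_number n (absolutely_convex hull A) \<le> c * S * real n powr (- \<beta>)"
    if A: "bounded A" "\<And>x. x \<in> A \<Longrightarrow> norm x \<le> T"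
      and T: "\<And>k. 1 \<le> k \<Longrightarrow> k \<le> n \<Longrightarrow> real k powr \<beta> * dyadic_entropy_number k A \<le> T" "0 \<le> T"
      and n: "1 \<le> n" and S: "T < S"
    for A :: "'a set" and T S :: real and n :: nat
  proof (cases "n \<le> K")
    case True
    have S0: "0 < S" using S T by simp
    have "dyadic_entropy_number n (absolutely_convex hull A) \<le> S"
    proof (rule dyadic_entropy_number_le)
      show "norm x \<le> S" if "x \<in> absolutely_convex hull A" for x
        using norm_le_on_absolutely_convex_hull[OF A(2) that] S by simp
    qed (use S0 in simp)
    also have "S \<le> c * S * real n powr (- \<beta>)"
    proof -
      have "real n powr \<beta> \<le> (2 * real K) powr \<beta>"
        using True \<beta> by (intro powr_mono2) auto
      also have "\<dots> \<le> c"
        using C mult_right_mono[of 1 "C + 1" "(2 * real K) powr \<beta>"] by (simp add: c_def)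
      finally have "S * (real n powr \<beta> * real n powr (- \<beta>)) \<le> S * (c * real n powr (- \<beta>))"
        using S0 by (intro mult_left_mono mult_right_mono) auto
      moreover have "real n powr \<beta> * real n powr (- \<beta>) = 1"
        using n by (simp add: powr_add[symmetric])
      ultimately show ?thesis by (simp add: mult_ac)
    qed
    finally show ?thesis .
  next
    case False
    have S0: "0 < S" using S T by simp
    have "\<exists>J. K * 2 ^ J < n \<and> n \<le> K * 2 ^ Suc J"
    proof -
      have ex: "n \<le> K * 2 ^ n"
      proof -
        have "n \<le> 2 ^ n" using less_exp[of n] by simp
        also have "\<dots> \<le> K * 2 ^ n" using K by simp
        finally show ?thesis .
      qed
      define L where "L = (LEAST L. n \<le> K * 2 ^ L)"
      have L: "n \<le> K * 2 ^ L" unfolding L_def by (rule LeastI[of "\<lambda>L. n \<le> K * 2 ^ L", OF ex])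
      moreover have "L \<noteq> 0" using L False by (intro notI) simp
      then obtain J where J: "L = Suc J" by (cases L) auto
      moreover have "\<not> n \<le> K * 2 ^ J"
        using not_less_Least[of J "\<lambda>L. n \<le> K * 2 ^ L"] J by (simp add: L_def)
      ultimately show ?thesis by (intro exI[of _ J]) simp
    qed
    then obtain J where J: "K * 2 ^ J < n" "n \<le> K * 2 ^ Suc J" by blast
    have "covers (2 ^ (K * 2 ^ J)) (C * S * 2 powr (- \<beta> * J)) (absolutely_convex hull A)"
    proof (rule main[OF S0])
      show "norm x \<le> S" if "x \<in> A" for x using A(2)[OF that] S by simp
      fix j assume j: "j \<le> J"
      define k where "k = (2::nat) ^ j"
      have k1: "1 \<le> k" by (simp add: k_def)
      have "k \<le> 2 ^ J" using j by (simp add: k_def)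
      also have "\<dots> \<le> K * 2 ^ J" using K by simp
      finally have k2: "k \<le> n" using J(1) by simp
      have powr_k: "real k powr \<beta> = 2 powr (\<beta> * j)"
        by (simp add: k_def powr_realpow[symmetric] powr_powr mult.commute)
      have "2 powr (\<beta> * j) * dyadic_entropy_number k A < S"
        using T(1)[OF k1 k2] S powr_k by simp
      then have "2 powr (- \<beta> * j) * (2 powr (\<beta> * j) * dyadic_entropy_number k A) < 2 powr (- \<beta> * j) * S"
        by (intro mult_strict_left_mono) auto
      moreover have "2 powr (- \<beta> * j) * 2 powr (\<beta> * j) = (1 :: real)"
        by (simp add: powr_add[symmetric])
      ultimately have "dyadic_entropy_number k A < 2 powr (- \<beta> * j) * S"
        by (simp only: mult.assoc[symmetric] mult_1_left)
      then have "entropy_number (2 ^ (k - 1)) A < S * 2 powr (- \<beta> * j)"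
        by (simp add: dyadic_entropy_number_def mult.commute)
      then have "covers (2 ^ (k - 1)) (S * 2 powr (- \<beta> * j)) A"
        by (intro covers_of_entropy_number_less A(1)) auto
      then show "covers (2 ^ (2 ^ j)) (S * 2 powr (- \<beta> * j)) A"
        by (rule covers_mono) (auto simp: k_def intro: power_increasing)
    qed
    then have "covers (2 ^ (n - 1)) (C * S * 2 powr (- \<beta> * J)) (absolutely_convex hull A)"
      by (rule covers_mono) (use J(1) in \<open>auto intro: power_increasing\<close>)
    then have "dyadic_entropy_number n (absolutely_convex hull A) \<le> C * S * 2 powr (- \<beta> * J)"
      unfolding dyadic_entropy_number_def using C S0 by (intro entropy_number_le) auto
    also have "2 powr (- \<beta> * J) \<le> (2 * real K) powr \<beta> * real n powr (- \<beta>)"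
    proof -
      have "real n \<le> real (K * 2 ^ Suc J)" using J(2) by (simp only: of_nat_le_iff)
      then have "real n \<le> 2 * real K * 2 powr real J" by (simp add: powr_realpow mult_ac)
      then have "(2 * real K * 2 powr real J) powr (- \<beta>) \<le> real n powr (- \<beta>)"
        using n \<beta> by (intro powr_mono2') auto
      moreover have "(2 * real K * 2 powr real J) powr (- \<beta>) = (2 * real K) powr (- \<beta>) * 2 powr (- \<beta> * J)"
        by (simp add: powr_mult powr_powr mult_ac)
      ultimately have "(2 * real K) powr \<beta> * ((2 * real K) powr (- \<beta>) * 2 powr (- \<beta> * J))
          \<le> (2 * real K) powr \<beta> * real n powr (- \<beta>)"
        by (intro mult_left_mono) auto
      moreover have "(2 * real K) powr \<beta> * (2 * real K) powr (- \<beta>) = 1"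
        using K by (simp add: powr_add[symmetric])
      ultimately show ?thesis by (simp add: mult.assoc[symmetric])
    qed
    then have "C * S * 2 powr (- \<beta> * J) \<le> C * S * ((2 * real K) powr \<beta> * real n powr (- \<beta>))"
      using C S0 by (intro mult_left_mono) auto
    also have "\<dots> \<le> (C + 1) * S * ((2 * real K) powr \<beta> * real n powr (- \<beta>))"
      using S0 by (intro mult_right_mono) auto
    also have "\<dots> = c * S * real n powr (- \<beta>)" by (simp add: c_def)
    finally show ?thesis .
  qed
  have c: "0 < c" using C K by (simp add: c_def)
  show ?thesis
  proof (rule that[OF c])
    fix A :: "'a set" and T :: real and n :: nat
    assume *: "bounded A" "\<And>x. x \<in> A \<Longrightarrow> norm x \<le> T"
      "\<And>k. 1 \<le> k \<Longrightarrow> k \<le> n \<Longrightarrow> real k powr \<beta> * dyadic_entropy_number k A \<le> T"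
      "0 \<le> T" "1 \<le> n"
    let ?b = "dyadic_entropy_number n (absolutely_convex hull A)"
    have pos: "0 < c * real n powr (- \<beta>)" using c *(5) by simp
    have "?b / (c * real n powr (- \<beta>)) \<le> T"
    proof (rule dense_ge)
      fix S assume "T < S"
      then have "?b \<le> c * S * real n powr (- \<beta>)" by (intro bound[OF *])
      then have "?b \<le> S * (c * real n powr (- \<beta>))" by (simp only: mult_ac)
      then show "?b / (c * real n powr (- \<beta>)) \<le> S" using pos by (simp only: pos_divide_le_eq)
    qed
    then have "?b \<le> T * (c * real n powr (- \<beta>))" using pos by (simp only: pos_divide_le_eq)
    then show "?b \<le> c * T * real n powr (- \<beta>)" by (simp only: mult_ac)
  qed
qed

section \<open>A Hardy-type inequality with logarithmic weights\<close>

text \<open>From \<open>(n + 1) / (k + 1) \<le> n / k\<close> the logarithms differ by at most \<open>log 2 (n / k)\<close>, and this is dominated by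
  any positive power of \<open>n / k\<close>.\<close>

lemma log_quotient_le:
  assumes "0 < \<epsilon>"
  obtains M where "1 \<le> M"
    "\<And>k n :: nat. 1 \<le> k \<Longrightarrow> k \<le> n \<Longrightarrow>
      log 2 (real n + 1) \<le> M * (real n / real k) powr \<epsilon> * log 2 (real k + 1)"
proof -
  define M where "M = 1 + 1 / (\<epsilon> * ln 2)"
  have M: "1 \<le> M" using assms by (simp add: M_def)
  have "log 2 (real n + 1) \<le> M * (real n / real k) powr \<epsilon> * log 2 (real k + 1)"
    if k: "1 \<le> k" "k \<le> n" for k n :: nat
  proof -
    let ?t = "real n / real k"
    have t: "1 \<le> ?t" using k by simp
    have Lk: "1 \<le> log 2 (real k + 1)" using k by simp
    have "real n + 1 \<le> (real k + 1) * ?t"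
      using k by (simp add: field_simps)
    then have "log 2 (real n + 1) \<le> log 2 ((real k + 1) * ?t)"
      using k by (intro log_mono) auto
    also have "\<dots> = log 2 (real k + 1) + log 2 ?t"
      using k t by (subst log_mult) auto
    also have "\<dots> \<le> log 2 (real k + 1) * (?t powr \<epsilon>) + log 2 (real k + 1) * (1 / (\<epsilon> * ln 2) * ?t powr \<epsilon>)"
    proof (rule add_mono)
      have "1 \<le> ?t powr \<epsilon>" using t assms by (intro ge_one_powr_ge_zero) auto
      then show "log 2 (real k + 1) \<le> log 2 (real k + 1) * (?t powr \<epsilon>)"
        using Lk by (simp add: mult_le_cancel_left1)
      have "log 2 ?t \<le> ?t powr \<epsilon> / \<epsilon> / ln 2"
        unfolding log_def using ln_powr_bound[OF t assms] by (intro divide_right_mono) auto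
      also have "\<dots> = 1 / (\<epsilon> * ln 2) * ?t powr \<epsilon>" by simp
      also have "\<dots> \<le> log 2 (real k + 1) * (1 / (\<epsilon> * ln 2) * ?t powr \<epsilon>)"
        using Lk assms mult_right_mono[OF Lk, of "1 / (\<epsilon> * ln 2) * ?t powr \<epsilon>"] by simp
      finally show "log 2 ?t \<le> log 2 (real k + 1) * (1 / (\<epsilon> * ln 2) * ?t powr \<epsilon>)" .
    qed
    also have "\<dots> = M * ?t powr \<epsilon> * log 2 (real k + 1)"
      by (simp add: M_def algebra_simps)
    finally show ?thesis .
  qed
  with M that show ?thesis by blast
qed

text \<open>A power of the logarithm, even an increasing one, is absorbed by any negative power. This reduces the
  logarithmic weights to pure powers.\<close>

lemma log_power_almost_decreasing:
  fixes \<alpha> \<eta> :: real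
  assumes "0 < \<eta>"
  obtains M where "0 < M"
    "\<And>k n :: nat. 1 \<le> k \<Longrightarrow> k \<le> n \<Longrightarrow>
      log 2 (real n + 1) powr (- \<alpha>) * real n powr (- \<eta>)
        \<le> M * (log 2 (real k + 1) powr (- \<alpha>) * real k powr (- \<eta>))"
proof (cases "0 \<le> \<alpha>")
  case True
  show ?thesis
  proof (rule that[of 1])
    fix k n :: nat assume k: "1 \<le> k" "k \<le> n"
    have "log 2 (real k + 1) \<le> log 2 (real n + 1)" "0 < log 2 (real k + 1)"
      using k by auto
    then have "log 2 (real n + 1) powr (- \<alpha>) * real n powr (- \<eta>)
        \<le> log 2 (real k + 1) powr (- \<alpha>) * real k powr (- \<eta>)"
      using k True assms by (intro mult_mono powr_mono2') auto
    then show "log 2 (real n + 1) powr (- \<alpha>) * real n powr (- \<eta>)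
        \<le> 1 * (log 2 (real k + 1) powr (- \<alpha>) * real k powr (- \<eta>))" by simp
  qed simp
next
  case False
  define a where "a = - \<alpha>"
  have a: "0 < a" using False by (simp add: a_def)
  obtain M where M: "1 \<le> M" and quot: "\<And>k n :: nat. 1 \<le> k \<Longrightarrow> k \<le> n \<Longrightarrow>
      log 2 (real n + 1) \<le> M * (real n / real k) powr (\<eta> / a) * log 2 (real k + 1)"
    using log_quotient_le[of "\<eta> / a"] a assms by auto
  show ?thesis
  proof (rule that[of "M powr a"])
    show "0 < M powr a" using M by simp
    fix k n :: nat assume k: "1 \<le> k" "k \<le> n"
    have pos: "0 \<le> log 2 (real k + 1)" "0 \<le> log 2 (real n + 1)" by auto
    have "log 2 (real n + 1) powr a \<le> (M * (real n / real k) powr (\<eta> / a) * log 2 (real k + 1)) powr a"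
      using quot[OF k] pos a by (intro powr_mono2) auto
    also have "\<dots> = M powr a * (real n / real k) powr \<eta> * log 2 (real k + 1) powr a"
      using M pos a by (simp add: powr_mult powr_powr)
    also have "\<dots> = M powr a * (log 2 (real k + 1) powr a * real k powr (- \<eta>)) * real n powr \<eta>"
    proof -
      have "(real n / real k) powr \<eta> = real n powr \<eta> * real k powr (- \<eta>)"
        by (simp add: powr_divide powr_minus divide_inverse[of "_ powr _"])
      then show ?thesis by (simp only: mult_ac)
    qed
    finally have "log 2 (real n + 1) powr a * real n powr (- \<eta>)
        \<le> M powr a * (log 2 (real k + 1) powr a * real k powr (- \<eta>)) * real n powr \<eta> * real n powr (- \<eta>)"
      by (rule mult_right_mono) simp
    also have "\<dots> = M powr a * (log 2 (real k + 1) powr a * real k powr (- \<eta>)) * (real n powr \<eta> * real n powr (- \<eta>))"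
      by (simp only: mult.assoc)
    also have "real n powr \<eta> * real n powr (- \<eta>) = 1"
      using k by (simp add: powr_add[symmetric])
    finally show "log 2 (real n + 1) powr (- \<alpha>) * real n powr (- \<eta>)
        \<le> M powr a * (log 2 (real k + 1) powr (- \<alpha>) * real k powr (- \<eta>))"
      by (simp add: a_def)
  qed
qed

text \<open>The upper half of the indices \<open>i \<le> k\<close> already suffices: there \<open>i\<close> and \<open>k\<close> are comparable, so it does not
  matter whether \<open>i powr (\<sigma> - 1)\<close> increases or decreases.\<close>

lemma power_le_sum:
  fixes \<sigma> :: real
  assumes "0 < \<sigma>"
  obtains M where "0 < M" "\<And>k :: nat. real k powr \<sigma> \<le> M * (\<Sum>i=1..k. real i powr (\<sigma> - 1))"
proof -
  define c where "c = min 1 ((1 / 2) powr (\<sigma> - 1))"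
  have c: "0 < c" by (simp add: c_def)
  have "real k powr \<sigma> \<le> 2 / c * (\<Sum>i=1..k. real i powr (\<sigma> - 1))" for k :: nat
  proof (cases "k = 0")
    case False
    let ?I = "{k - k div 2..k}"
    have summand: "c * real k powr (\<sigma> - 1) \<le> real i powr (\<sigma> - 1)" if "i \<in> ?I" for i
    proof (cases "1 \<le> \<sigma>")
      case True
      have "real k \<le> 2 * real i" using that by auto
      have "c * real k powr (\<sigma> - 1) \<le> (1 / 2) powr (\<sigma> - 1) * real k powr (\<sigma> - 1)"
        by (intro mult_right_mono) (auto simp: c_def)
      also have "\<dots> = (1 / 2 * real k) powr (\<sigma> - 1)"
        by (rule powr_mult[symmetric])
      also have "\<dots> \<le> real i powr (\<sigma> - 1)"
        using True \<open>real k \<le> 2 * real i\<close> by (intro powr_mono2) auto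
      finally show ?thesis .
    next
      case False
      have i: "0 < i" "i \<le> k" using that \<open>k \<noteq> 0\<close> by auto
      have "c * real k powr (\<sigma> - 1) \<le> 1 * real k powr (\<sigma> - 1)"
        by (intro mult_right_mono) (auto simp: c_def)
      also have "\<dots> \<le> real i powr (\<sigma> - 1)"
        using i False by (simp add: powr_mono2')
      finally show ?thesis .
    qed
    have "real k powr \<sigma> = real k * real k powr (\<sigma> - 1)"
      using False by (simp add: powr_diff)
    also have "\<dots> \<le> (2 * real (card ?I)) * real k powr (\<sigma> - 1)"
    proof (rule mult_right_mono)
      have "card ?I = k div 2 + 1" by simp
      then show "real k \<le> 2 * real (card ?I)" by linarith
    qed simp
    also have "\<dots> = 2 / c * (\<Sum>i\<in>?I. c * real k powr (\<sigma> - 1))"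
      using c by (simp add: field_simps)
    also have "\<dots> \<le> 2 / c * (\<Sum>i\<in>?I. real i powr (\<sigma> - 1))"
      using c summand by (intro mult_left_mono sum_mono) auto
    also have "\<dots> \<le> 2 / c * (\<Sum>i=1..k. real i powr (\<sigma> - 1))"
      using c False by (intro mult_left_mono sum_mono2) auto
    finally show ?thesis .
  qed simp
  with c that[of "2 / c"] show ?thesis by simp
qed

text \<open>By the mean value theorem each term is dominated by a difference of consecutive values of
  \<open>n powr (- \<theta>)\<close>, and the differences telescope.\<close>

lemma tail_sum_le:
  fixes \<theta> :: real
  assumes "0 < \<theta>"
  obtains M where "0 < M"
    "\<And>i N :: nat. 1 \<le> i \<Longrightarrow> (\<Sum>n=i..N. real n powr (- \<theta> - 1)) \<le> M * real i powr (- \<theta>)"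
proof -
  define M where "M = 2 powr (\<theta> + 1) / \<theta>"
  have M: "0 < M" using assms by (simp add: M_def)
  have step: "real n powr (- \<theta> - 1) \<le> M * (real n powr (- \<theta>) - real (Suc n) powr (- \<theta>))"
    if n: "1 \<le> n" for n :: nat
  proof -
    have "\<exists>z>real n. z < real (Suc n) \<and> real (Suc n) powr (- \<theta>) - real n powr (- \<theta>)
        = (real (Suc n) - real n) * (- \<theta> * z powr (- \<theta> - 1))"
      using n by (intro MVT2) (auto intro!: derivative_eq_intros)
    then obtain z where z: "real n < z" "z < real (Suc n)"
      "real n powr (- \<theta>) - real (Suc n) powr (- \<theta>) = \<theta> * z powr (- \<theta> - 1)" by auto
    have "(2 * real n) powr (- \<theta> - 1) \<le> z powr (- \<theta> - 1)"
      using z n assms by (intro powr_mono2') auto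
    then have "\<theta> * (2 powr (- \<theta> - 1) * real n powr (- \<theta> - 1))
        \<le> real n powr (- \<theta>) - real (Suc n) powr (- \<theta>)"
      using z(3) assms by (simp add: powr_mult)
    then have "M * (\<theta> * (2 powr (- \<theta> - 1) * real n powr (- \<theta> - 1)))
        \<le> M * (real n powr (- \<theta>) - real (Suc n) powr (- \<theta>))"
      using M by (intro mult_left_mono) auto
    moreover have "M * \<theta> * 2 powr (- \<theta> - 1) = 1"
      using assms by (simp add: M_def powr_add[symmetric])
    ultimately show ?thesis by (simp add: mult.assoc[symmetric])
  qed
  have "(\<Sum>n=i..N. real n powr (- \<theta> - 1)) \<le> M * real i powr (- \<theta>)" if i: "1 \<le> i" for i N :: nat
  proof (cases "i \<le> N")
    case True
    have "(\<Sum>n=i..N. real n powr (- \<theta> - 1))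
        \<le> (\<Sum>n=i..N. M * (real n powr (- \<theta>) - real (Suc n) powr (- \<theta>)))"
      using step i by (intro sum_mono) auto
    also have "\<dots> = M * - (\<Sum>n=i..N. real (Suc n) powr (- \<theta>) - real n powr (- \<theta>))"
      by (simp only: sum_distrib_left[symmetric] sum_negf[symmetric] minus_diff_eq)
    also have "\<dots> = M * (real i powr (- \<theta>) - real (Suc N) powr (- \<theta>))"
      using sum_Suc_diff[of i N "\<lambda>n. real n powr (- \<theta>)"] True by simp
    also have "\<dots> \<le> M * real i powr (- \<theta>)"
      using M by (intro mult_left_mono) auto
    finally show ?thesis .
  qed (use M in simp)
  with M that show ?thesis by blast
qed

lemma sum_triangle_swap:
  fixes f :: "nat \<Rightarrow> nat \<Rightarrow> 'a::comm_monoid_add"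
  shows "(\<Sum>n=1..N. \<Sum>i=1..n. f n i) = (\<Sum>i=1..N. \<Sum>n=i..N. f n i)"
proof -
  have "(\<Sum>n=1..N. \<Sum>i=1..n. f n i) = (\<Sum>n=1..N. \<Sum>i | i \<in> {1..N} \<and> i \<le> n. f n i)"
    by (intro sum.cong refl) auto
  also have "\<dots> = (\<Sum>i=1..N. \<Sum>n | n \<in> {1..N} \<and> i \<le> n. f n i)"
    by (rule sum.swap_restrict) auto
  also have "\<dots> = (\<Sum>i=1..N. \<Sum>n=i..N. f n i)"
    by (intro sum.cong refl) auto
  finally show ?thesis .
qed

text \<open>For a non-increasing sequence \<open>a\<close> a single term is controlled by a sum:
  \<open>k\<^sup>\<sigma> a\<^sub>k\<^sup>s \<le> M \<Sum>\<^bsub>i \<le> k\<^esub> i\<^sup>\<sigma>\<^sup>-\<^sup>1 a\<^sub>i\<^sup>s\<close> with \<open>\<sigma> = s \<beta>\<close>. Thus \<open>b\<^sub>n\<^sup>s\<close> is at most a multiple of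
  \<open>n\<^sup>-\<^sup>\<sigma> \<Sum>\<^bsub>i \<le> n\<^esub> i\<^sup>\<sigma>\<^sup>-\<^sup>1 a\<^sub>i\<^sup>s\<close>, and after exchanging the summations the sum over \<open>n \<ge> i\<close> converges,
  since \<open>\<sigma> > s v\<close>. This route treats \<open>s < 1\<close> and \<open>s \<ge> 1\<close> alike.\<close>

lemma log_weighted_hardy_sum:
  fixes \<alpha> v \<beta> s C :: real
  assumes v: "0 < v" "v < \<beta>" and s: "0 < s" and C: "0 < C"
  obtains c where "0 < c"
    "\<And>(a :: nat \<Rightarrow> real) b N. antimono_on {1..} a \<Longrightarrow> (\<And>n. 1 \<le> n \<Longrightarrow> 0 \<le> a n) \<Longrightarrow>
      (\<And>n. 1 \<le> n \<Longrightarrow> 0 \<le> b n) \<Longrightarrow>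
      (\<And>n. 1 \<le> n \<Longrightarrow> \<exists>k\<in>{1..n}. b n \<le> C * (real k powr \<beta> * a k) * real n powr (- \<beta>)) \<Longrightarrow>
      (\<Sum>n=1..N. log 2 (real n + 1) powr (- \<alpha>) * real n powr (s * v - 1) * b n powr s)
        \<le> c * (\<Sum>n=1..N. log 2 (real n + 1) powr (- \<alpha>) * real n powr (s * v - 1) * a n powr s)"
proof -
  define \<sigma> where "\<sigma> = s * \<beta>"
  define \<theta> where "\<theta> = s * (\<beta> - v) / 2"
  have \<sigma>: "0 < \<sigma>" and \<theta>: "0 < \<theta>" using v s by (auto simp: \<sigma>_def \<theta>_def)
  have \<sigma>\<theta>: "s * v - 1 - \<sigma> = - 2 * \<theta> - 1" by (simp add: \<sigma>_def \<theta>_def field_simps)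
  obtain M1 where M1: "0 < M1" "\<And>k :: nat. real k powr \<sigma> \<le> M1 * (\<Sum>i=1..k. real i powr (\<sigma> - 1))"
    using power_le_sum[OF \<sigma>] by blast
  obtain M2 where M2: "0 < M2"
    "\<And>i N :: nat. 1 \<le> i \<Longrightarrow> (\<Sum>n=i..N. real n powr (- \<theta> - 1)) \<le> M2 * real i powr (- \<theta>)"
    using tail_sum_le[OF \<theta>] by blast
  obtain M3 where M3: "0 < M3"
    "\<And>k n :: nat. 1 \<le> k \<Longrightarrow> k \<le> n \<Longrightarrow>
      log 2 (real n + 1) powr (- \<alpha>) * real n powr (- \<theta>)
        \<le> M3 * (log 2 (real k + 1) powr (- \<alpha>) * real k powr (- \<theta>))"
    using log_power_almost_decreasing[OF \<theta>] by blast
  let ?L = "\<lambda>n::nat. log 2 (real n + 1) powr (- \<alpha>)"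
  define c where "c = C powr s * M1 * (M3 * M2)"
  have c: "0 < c" using C M1 M2 M3 by (simp add: c_def)
  have tail: "(\<Sum>n=i..N. ?L n * real n powr (- 2 * \<theta> - 1)) \<le> M3 * M2 * (?L i * real i powr (- 2 * \<theta>))"
    if i: "1 \<le> i" for i N :: nat
  proof -
    have "(\<Sum>n=i..N. ?L n * real n powr (- 2 * \<theta> - 1))
        = (\<Sum>n=i..N. (?L n * real n powr (- \<theta>)) * real n powr (- \<theta> - 1))"
      by (simp add: mult.assoc powr_add[symmetric])
    also have "\<dots> \<le> (\<Sum>n=i..N. (M3 * (?L i * real i powr (- \<theta>))) * real n powr (- \<theta> - 1))"
      using M3(2)[OF i] by (intro sum_mono mult_right_mono) auto
    also have "\<dots> = M3 * (?L i * real i powr (- \<theta>)) * (\<Sum>n=i..N. real n powr (- \<theta> - 1))"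
      by (simp only: sum_distrib_left)
    also have "\<dots> \<le> M3 * (?L i * real i powr (- \<theta>)) * (M2 * real i powr (- \<theta>))"
      using M2(2)[OF i] M3(1) by (intro mult_left_mono) auto
    also have "\<dots> = M3 * M2 * (?L i * (real i powr (- \<theta>) * real i powr (- \<theta>)))"
      by (simp only: mult_ac)
    also have "real i powr (- \<theta>) * real i powr (- \<theta>) = real i powr (- 2 * \<theta>)"
      by (simp add: powr_add[symmetric])
    finally show ?thesis .
  qed
  have "(\<Sum>n=1..N. ?L n * real n powr (s * v - 1) * b n powr s)
        \<le> c * (\<Sum>n=1..N. ?L n * real n powr (s * v - 1) * a n powr s)"
    if a: "antimono_on {1..} a" "\<And>n. 1 \<le> n \<Longrightarrow> 0 \<le> a n" and b: "\<And>n. 1 \<le> n \<Longrightarrow> 0 \<le> b n"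
      and ab: "\<And>n. 1 \<le> n \<Longrightarrow> \<exists>k\<in>{1..n}. b n \<le> C * (real k powr \<beta> * a k) * real n powr (- \<beta>)"
    for a b :: "nat \<Rightarrow> real" and N :: nat
  proof -
    define F where "F i = real i powr (\<sigma> - 1) * a i powr s" for i
    have bn: "b n powr s \<le> C powr s * M1 * real n powr (- \<sigma>) * (\<Sum>i=1..n. F i)" if n: "1 \<le> n" for n
    proof -
      obtain k where k: "1 \<le> k" "k \<le> n" "b n \<le> C * (real k powr \<beta> * a k) * real n powr (- \<beta>)"
        using ab[OF n] by auto
      have "b n powr s \<le> (C * (real k powr \<beta> * a k) * real n powr (- \<beta>)) powr s"
        using k b[OF n] s by (intro powr_mono2) auto
      also have "\<dots> = C powr s * (real k powr \<sigma> * a k powr s) * real n powr (- \<sigma>)"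
        using C a(2)[OF k(1)] by (simp add: powr_mult powr_powr \<sigma>_def mult.commute)
      also have "\<dots> \<le> C powr s * (M1 * (\<Sum>i=1..n. F i)) * real n powr (- \<sigma>)"
      proof (intro mult_right_mono mult_left_mono)
        have "real k powr \<sigma> * a k powr s \<le> (M1 * (\<Sum>i=1..k. real i powr (\<sigma> - 1))) * a k powr s"
          using M1(2) by (intro mult_right_mono) auto
        also have "\<dots> = M1 * (\<Sum>i=1..k. real i powr (\<sigma> - 1) * a k powr s)"
          by (simp only: sum_distrib_right mult.assoc)
        also have "\<dots> \<le> M1 * (\<Sum>i=1..k. F i)"
        proof (intro mult_left_mono sum_mono)
          fix i assume i: "i \<in> {1..k}"
          then have "a k \<le> a i" using a(1) by (auto simp: monotone_on_def)
          then show "real i powr (\<sigma> - 1) * a k powr s \<le> F i"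
            unfolding F_def using a(2)[OF k(1)] s by (intro mult_left_mono powr_mono2) auto
        qed (use M1 in simp)
        also have "\<dots> \<le> M1 * (\<Sum>i=1..n. F i)"
          using k M1 by (intro mult_left_mono sum_mono2) (auto simp: F_def)
        finally show "real k powr \<sigma> * a k powr s \<le> M1 * (\<Sum>i=1..n. F i)" .
      qed auto
      finally show ?thesis by (simp only: mult_ac)
    qed
    have "(\<Sum>n=1..N. ?L n * real n powr (s * v - 1) * b n powr s)
        \<le> (\<Sum>n=1..N. ?L n * real n powr (s * v - 1) * (C powr s * M1 * real n powr (- \<sigma>) * (\<Sum>i=1..n. F i)))"
      using bn by (intro sum_mono mult_left_mono) auto
    also have "\<dots> = (\<Sum>n=1..N. \<Sum>i=1..n. C powr s * M1 * F i * (?L n * real n powr (- 2 * \<theta> - 1)))"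
    proof (rule sum.cong[OF refl])
      fix n
      have exponent: "real n powr (s * v - 1) * real n powr (- \<sigma>) = real n powr (- 2 * \<theta> - 1)"
        unfolding \<sigma>\<theta>[symmetric] by (simp add: powr_add[symmetric])
      have "?L n * real n powr (s * v - 1) * (C powr s * M1 * real n powr (- \<sigma>) * (\<Sum>i=1..n. F i))
          = C powr s * M1 * (?L n * (real n powr (s * v - 1) * real n powr (- \<sigma>))) * (\<Sum>i=1..n. F i)"
        by (simp only: mult_ac)
      also have "\<dots> = C powr s * M1 * (?L n * real n powr (- 2 * \<theta> - 1)) * (\<Sum>i=1..n. F i)"
        by (simp only: exponent)
      also have "\<dots> = (\<Sum>i=1..n. C powr s * M1 * F i * (?L n * real n powr (- 2 * \<theta> - 1)))"
        unfolding sum_distrib_left by (intro sum.cong refl) (simp only: mult_ac)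
      finally show "?L n * real n powr (s * v - 1) * (C powr s * M1 * real n powr (- \<sigma>) * (\<Sum>i=1..n. F i))
          = (\<Sum>i=1..n. C powr s * M1 * F i * (?L n * real n powr (- 2 * \<theta> - 1)))" .
    qed
    also have "\<dots> = (\<Sum>i=1..N. \<Sum>n=i..N. C powr s * M1 * F i * (?L n * real n powr (- 2 * \<theta> - 1)))"
      by (rule sum_triangle_swap)
    also have "\<dots> = (\<Sum>i=1..N. C powr s * M1 * F i * (\<Sum>n=i..N. ?L n * real n powr (- 2 * \<theta> - 1)))"
      by (simp only: sum_distrib_left)
    also have "\<dots> \<le> (\<Sum>i=1..N. C powr s * M1 * F i * (M3 * M2 * (?L i * real i powr (- 2 * \<theta>))))"
      using tail C M1 by (intro sum_mono mult_left_mono) (auto simp: F_def)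
    also have "\<dots> = (\<Sum>i=1..N. c * (?L i * real i powr (s * v - 1) * a i powr s))"
    proof (rule sum.cong[OF refl])
      fix i
      have "\<sigma> - 1 + - 2 * \<theta> = s * v - 1" using \<sigma>\<theta> by linarith
      then have exponent: "real i powr (\<sigma> - 1) * real i powr (- 2 * \<theta>) = real i powr (s * v - 1)"
        by (simp only: powr_add[symmetric])
      have "C powr s * M1 * F i * (M3 * M2 * (?L i * real i powr (- 2 * \<theta>)))
          = c * (?L i * (real i powr (\<sigma> - 1) * real i powr (- 2 * \<theta>)) * a i powr s)"
        unfolding F_def c_def by (simp only: mult_ac)
      then show "C powr s * M1 * F i * (M3 * M2 * (?L i * real i powr (- 2 * \<theta>)))
          = c * (?L i * real i powr (s * v - 1) * a i powr s)"
        by (simp only: exponent)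
    qed
    finally show ?thesis by (simp only: sum_distrib_left)
  qed
  with c that show ?thesis by blast
qed

text \<open>After the powers are collected, the quotient of the logarithmic factors at \<open>n\<close> and \<open>k\<close> remains,
  multiplied by \<open>(k / n) powr (\<beta> - v)\<close>, which absorbs it up to a constant.\<close>

lemma log_weighted_hardy_term:
  fixes \<alpha> v \<beta> C :: real
  assumes v: "v < \<beta>" and C: "0 < C"
  obtains c where "0 < c"
    "\<And>a b n k. 0 \<le> a \<Longrightarrow> 1 \<le> k \<Longrightarrow> k \<le> n \<Longrightarrow>
      b \<le> C * (real k powr \<beta> * a) * real n powr (- \<beta>) \<Longrightarrow>
      log 2 (real n + 1) powr (- \<alpha>) * real n powr v * b
        \<le> c * (log 2 (real k + 1) powr (- \<alpha>) * real k powr v * a)"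
proof -
  obtain M where M: "0 < M"
    "\<And>k n :: nat. 1 \<le> k \<Longrightarrow> k \<le> n \<Longrightarrow>
      log 2 (real n + 1) powr (- \<alpha>) * real n powr (- (\<beta> - v))
        \<le> M * (log 2 (real k + 1) powr (- \<alpha>) * real k powr (- (\<beta> - v)))"
    using log_power_almost_decreasing[of "\<beta> - v"] v by auto
  let ?L = "\<lambda>n::nat. log 2 (real n + 1) powr (- \<alpha>)"
  have "?L n * real n powr v * b \<le> C * M * (?L k * real k powr v * a)"
    if "0 \<le> a" "1 \<le> k" "k \<le> n" "b \<le> C * (real k powr \<beta> * a) * real n powr (- \<beta>)"
    for a b :: real and k n :: nat
  proof -
    have "?L n * real n powr v * b \<le> ?L n * real n powr v * (C * (real k powr \<beta> * a) * real n powr (- \<beta>))"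
      using that by (intro mult_left_mono) auto
    also have "\<dots> = C * (real k powr \<beta> * a) * (?L n * (real n powr v * real n powr (- \<beta>)))"
      by (simp only: mult_ac)
    also have "real n powr v * real n powr (- \<beta>) = real n powr (- (\<beta> - v))"
      by (simp add: powr_add[symmetric])
    also have "C * (real k powr \<beta> * a) * (?L n * real n powr (- (\<beta> - v)))
        \<le> C * (real k powr \<beta> * a) * (M * (?L k * real k powr (- (\<beta> - v))))"
      using M(2)[OF that(2,3)] that(1) C by (intro mult_left_mono) auto
    also have "\<dots> = C * M * (?L k * (real k powr \<beta> * real k powr (- (\<beta> - v))) * a)"
      by (simp only: mult_ac)
    also have "real k powr \<beta> * real k powr (- (\<beta> - v)) = real k powr v"
      by (simp add: powr_add[symmetric])
    finally show ?thesis .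
  qed
  with that[of "C * M"] C M show ?thesis by simp
qed

section \<open>Transfer to weighted sums and Lorentz spaces\<close>

text \<open>The entropy numbers of \<open>A\<close> do not see its distance from the origin, which the hull does; the
  supremum of the norms in the first place makes up for this and keeps the sequence non-increasing.\<close>

definition anchored_entropy :: "'a::real_normed_vector set \<Rightarrow> nat \<Rightarrow> real"
  where "anchored_entropy A n = (if n \<le> 1 then SUP x\<in>A. norm x else dyadic_entropy_number n A)"

lemma norm_le_SUP:
  assumes "bounded A" "x \<in> A"
  shows "norm x \<le> (SUP x\<in>A. norm x)"
  using assms by (intro cSUP_upper) (auto simp: bounded_iff intro: bdd_aboveI2)

lemma SUP_norm_nonneg: "bounded A \<Longrightarrow> A \<noteq> {} \<Longrightarrow> 0 \<le> (SUP x\<in>A. norm x)"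
  using norm_le_SUP norm_ge_zero order_trans by (metis ex_in_conv)

lemma entropy_le_anchored_entropy:
  assumes "bounded A" "A \<noteq> {}"
  shows "dyadic_entropy_number n A \<le> anchored_entropy A n"
  using dyadic_entropy_number_le[of A "SUP x\<in>A. norm x" n] norm_le_SUP SUP_norm_nonneg assms
  by (auto simp: anchored_entropy_def)

lemma anchored_entropy_nonneg:
  assumes "bounded A" "A \<noteq> {}"
  shows "0 \<le> anchored_entropy A n"
  using entropy_le_anchored_entropy[OF assms] dyadic_entropy_number_nonneg[OF assms(1)] order_trans
  by blast

lemma antimono_anchored_entropy:
  assumes "bounded A" "A \<noteq> {}"
  shows "antimono_on {1..} (anchored_entropy A)"
proof (rule monotone_onI)
  fix m n :: nat assume mn: "m \<in> {1..}" "n \<in> {1..}" "m \<le> n"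
  show "anchored_entropy A n \<le> anchored_entropy A m"
  proof (cases "n \<le> 1")
    case True
    then show ?thesis using mn by (simp add: anchored_entropy_def)
  next
    case False
    then have "anchored_entropy A n = dyadic_entropy_number n A"
      by (simp add: anchored_entropy_def)
    also have "\<dots> \<le> dyadic_entropy_number m A"
      using mn assms by (intro dyadic_entropy_number_mono) auto
    also have "\<dots> \<le> anchored_entropy A m"
      by (rule entropy_le_anchored_entropy[OF assms])
    finally show ?thesis .
  qed
qed

text \<open>The index \<open>k\<close> is one that maximises \<open>k\<^sup>\<beta> a\<^sub>k\<close>, where \<open>a\<close> is the anchored sequence; this maximum
  serves as the bound \<open>T\<close> for both the entropy numbers and the norms.\<close>

lemma hull_entropy_le_anchored_entropy:
  assumes signs: "sign_type TYPE('a::real_normed_vector) p \<rho>"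
    and \<rho>: "0 < \<rho>" and p: "1 < p" and \<beta>: "0 < \<beta>" "\<beta> < 1 - 1 / p"
  obtains C :: real where "0 < C"
    "\<And>(A :: 'a set) n. bounded A \<Longrightarrow> A \<noteq> {} \<Longrightarrow> 1 \<le> n \<Longrightarrow>
      \<exists>k\<in>{1..n}. dyadic_entropy_number n (absolutely_convex hull A)
        \<le> C * (real k powr \<beta> * anchored_entropy A k) * real n powr (- \<beta>)"
proof -
  obtain C :: real where C: "0 < C" and main:
    "\<And>(A :: 'a set) T n. bounded A \<Longrightarrow> (\<And>x. x \<in> A \<Longrightarrow> norm x \<le> T) \<Longrightarrow>
      (\<And>k. 1 \<le> k \<Longrightarrow> k \<le> n \<Longrightarrow> real k powr \<beta> * dyadic_entropy_number k A \<le> T) \<Longrightarrow>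
      0 \<le> T \<Longrightarrow> 1 \<le> n \<Longrightarrow>
      dyadic_entropy_number n (absolutely_convex hull A) \<le> C * T * real n powr (- \<beta>)"
    using entropy_absolutely_convex_hull[OF signs \<rho> p \<beta>] by blast
  show ?thesis
  proof (rule that[OF C])
    fix A :: "'a set" and n :: nat
    assume A: "bounded A" "A \<noteq> {}" and n: "1 \<le> n"
    let ?g = "\<lambda>k. real k powr \<beta> * anchored_entropy A k"
    let ?T = "Max (?g ` {1..n})"
    have "?T \<in> ?g ` {1..n}" using n by (intro Max_in) auto
    then obtain k where k: "k \<in> {1..n}" "?T = ?g k" by (elim imageE)
    have T: "?g i \<le> ?T" if "1 \<le> i" "i \<le> n" for i
      using that by (intro Max_ge) auto
    have "dyadic_entropy_number n (absolutely_convex hull A) \<le> C * ?T * real n powr (- \<beta>)"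
    proof (rule main[OF A(1) _ _ _ n])
      show "norm x \<le> ?T" if "x \<in> A" for x
        using norm_le_SUP[OF A(1) that] T[of 1] n by (simp add: anchored_entropy_def)
      show "real i powr \<beta> * dyadic_entropy_number i A \<le> ?T" if "1 \<le> i" "i \<le> n" for i
        using T[OF that] mult_left_mono[OF entropy_le_anchored_entropy[OF A, of i], of "real i powr \<beta>"]
        by simp
      show "0 \<le> ?T"
        unfolding k(2) using anchored_entropy_nonneg[OF A] by simp
    qed
    then show "\<exists>k\<in>{1..n}. dyadic_entropy_number n (absolutely_convex hull A)
        \<le> C * (real k powr \<beta> * anchored_entropy A k) * real n powr (- \<beta>)"
      unfolding k(2) using k(1) by (rule bexI)
  qed
qed

text \<open>For entropy numbers of a bounded set the monotonicity, sign and boundedness conditions in a Lorentz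
  space hold automatically; only the growth condition remains.\<close>

lemma lorentz_seq_entropy_iff:
  assumes "bounded A"
  shows "(\<lambda>n. dyadic_entropy_number n A) \<in> lorentz_seq r s \<alpha> \<longleftrightarrow>
    (if s = \<infinity>
     then bdd_above ((\<lambda>n. log 2 (real n + 1) powr (- \<alpha>) * real n powr (1 / r) * dyadic_entropy_number n A) ` {1..})
     else (\<lambda>n. log 2 (real n + 1) powr (- \<alpha> * real_of_ereal s) * real n powr (real_of_ereal s / r - 1)
         * dyadic_entropy_number n A powr real_of_ereal s) summable_on {1..})"
proof -
  have "antimono_on {1..} (\<lambda>n. dyadic_entropy_number n A)"
    by (intro monotone_onI) (use assms in \<open>auto intro: dyadic_entropy_number_mono\<close>)
  moreover have "bounded ((\<lambda>n. dyadic_entropy_number n A) ` {1..})"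
    unfolding bounded_iff
    using dyadic_entropy_number_nonneg[OF assms] dyadic_entropy_number_mono[OF assms order_refl, of 1]
    by (intro exI[of _ "dyadic_entropy_number 1 A"]) auto
  ultimately show ?thesis
    using dyadic_entropy_number_nonneg[OF assms] by (simp add: lorentz_seq_def Let_def)
qed

lemma lorentz_seq_entropy_mono:
  assumes B: "bounded B" and AB: "A \<subseteq> B" and s: "0 < s"
    and mem: "(\<lambda>n. dyadic_entropy_number n B) \<in> lorentz_seq r s \<alpha>"
  shows "(\<lambda>n. dyadic_entropy_number n A) \<in> lorentz_seq r s \<alpha>"
proof -
  have A: "bounded A" using B AB by (rule bounded_subset)
  have le: "dyadic_entropy_number n A \<le> dyadic_entropy_number n B" for n
    using B AB by (rule dyadic_entropy_number_mono) simp
  show ?thesis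
  proof (cases "s = \<infinity>")
    case True
    then obtain M where "\<And>n. n \<in> {1..} \<Longrightarrow>
        log 2 (real n + 1) powr (- \<alpha>) * real n powr (1 / r) * dyadic_entropy_number n B \<le> M"
      using mem unfolding lorentz_seq_entropy_iff[OF B] by (auto simp: bdd_above_def)
    moreover have "log 2 (real n + 1) powr (- \<alpha>) * real n powr (1 / r) * dyadic_entropy_number n A
        \<le> log 2 (real n + 1) powr (- \<alpha>) * real n powr (1 / r) * dyadic_entropy_number n B" for n
      using le by (intro mult_left_mono) auto
    ultimately have "log 2 (real n + 1) powr (- \<alpha>) * real n powr (1 / r) * dyadic_entropy_number n A \<le> M"
      if "n \<in> {1..}" for n using that order_trans by blast
    then have "bdd_above ((\<lambda>n. log 2 (real n + 1) powr (- \<alpha>) * real n powr (1 / r) * dyadic_entropy_number n A) ` {1..})"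
      by (rule bdd_aboveI2)
    then show ?thesis
      unfolding lorentz_seq_entropy_iff[OF A] using True by simp
  next
    case False
    then have s': "0 < real_of_ereal s" using s by (cases s) auto
    have "(\<lambda>n. log 2 (real n + 1) powr (- \<alpha> * real_of_ereal s) * real n powr (real_of_ereal s / r - 1)
         * dyadic_entropy_number n A powr real_of_ereal s) summable_on {1..}"
    proof (rule summable_on_comparison_test)
      show "(\<lambda>n. log 2 (real n + 1) powr (- \<alpha> * real_of_ereal s) * real n powr (real_of_ereal s / r - 1)
         * dyadic_entropy_number n B powr real_of_ereal s) summable_on {1..}"
        using mem False unfolding lorentz_seq_entropy_iff[OF B] by simp
    qed (use le s' dyadic_entropy_number_nonneg[OF A] in \<open>auto intro!: mult_left_mono powr_mono2\<close>)
    then show ?thesis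
      unfolding lorentz_seq_entropy_iff[OF A] using False by simp
  qed
qed

text \<open>In the first place this is an equality; elsewhere it holds because \<open>e\<^sub>1(A)\<close> is at most the
  supremum of the norms (take the origin as centre).\<close>

lemma anchored_entropy_le:
  assumes A: "bounded A" and pos: "0 < entropy_number 1 A" and n: "1 \<le> n"
  shows "anchored_entropy A n \<le> (SUP x\<in>A. norm x) / entropy_number 1 A * dyadic_entropy_number n A"
proof -
  have ne: "A \<noteq> {}" using pos by (rule nonempty_of_entropy_number_pos)
  show ?thesis
  proof (cases "n = 1")
    case True
    then show ?thesis using pos by (simp add: anchored_entropy_def dyadic_entropy_number_def)
  next
    case False
    have "entropy_number 1 A \<le> (SUP x\<in>A. norm x)"
      using entropy_le_anchored_entropy[OF A ne, of 1]
      by (simp add: anchored_entropy_def dyadic_entropy_number_def)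
    then have "1 \<le> (SUP x\<in>A. norm x) / entropy_number 1 A" using pos by simp
    then have "1 * dyadic_entropy_number n A \<le> (SUP x\<in>A. norm x) / entropy_number 1 A * dyadic_entropy_number n A"
      using dyadic_entropy_number_nonneg[OF A] by (rule mult_right_mono)
    then show ?thesis using False n by (simp add: anchored_entropy_def)
  qed
qed

theorem theorem2p4:
  fixes p p' r \<alpha> :: real
  assumes "banach_type TYPE('a::banach) p" and "1 < p" and "p \<le> 2"
    and "1 / p + 1 / p' = 1" and "p' < r"
  shows "(\<forall>s::real. 0 < s \<longrightarrow>
      (\<exists>c>0. \<forall>(N::nat) (A :: 'a set).
        1 \<le> N \<longrightarrow> totally_bounded A \<longrightarrow> 0 < entropy_number 1 A \<longrightarrow>
        (let c\<^sub>A = (SUP x\<in>A. norm x) / entropy_number 1 A in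
          (\<Sum>n=1..N. (log 2 (real n + 1)) powr (- \<alpha>) * real n powr (s / r - 1) *
              dyadic_entropy_number n (absolutely_convex hull A) powr s)
            \<le> c * c\<^sub>A powr s *
              (\<Sum>n=1..N. (log 2 (real n + 1)) powr (- \<alpha>) * real n powr (s / r - 1) *
                dyadic_entropy_number n A powr s) \<and>
          (SUP n\<in>{1..N}. (log 2 (real n + 1)) powr (- \<alpha>) * real n powr (1 / r) *
              dyadic_entropy_number n (absolutely_convex hull A))
            \<le> c * c\<^sub>A *
              (SUP n\<in>{1..N}. (log 2 (real n + 1)) powr (- \<alpha>) * real n powr (1 / r) *
                dyadic_entropy_number n A))))
    \<and> (\<forall>s::ereal. 0 < s \<longrightarrow>
      (\<forall>A :: 'a set. totally_bounded A \<longrightarrow>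
        ((\<lambda>n. dyadic_entropy_number n A) \<in> lorentz_seq r s \<alpha> \<longleftrightarrow>
         (\<lambda>n. dyadic_entropy_number n (absolutely_convex hull A)) \<in> lorentz_seq r s \<alpha>)))"
proof -
  obtain \<rho> where \<rho>: "0 < \<rho>" and signs:
    "sign_type TYPE('a) p \<rho>"
    using banach_type_imp_sign_type[OF assms(1)] by blast
  define v where "v = 1 / r"
  define \<beta> where "\<beta> = (v + (1 - 1 / p)) / 2"
  have "0 < p'" 
  proof -
    have "1 / p' = 1 - 1 / p" using assms(4) by linarith
    moreover have "0 < 1 - 1 / p" using assms(2) by simp
    ultimately have "0 < 1 / p'" by linarith
    then show ?thesis by simp
  qed
  then have v: "0 < v" "v < 1 - 1 / p"
    using assms(4,5) by (simp_all add: v_def) (smt (verit) frac_less2)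
  have \<beta>: "0 < \<beta>" "v < \<beta>" "\<beta> < 1 - 1 / p" using v by (auto simp: \<beta>_def)
  obtain C :: real where C: "0 < C" and hull:
    "\<And>(A :: 'a set) n. bounded A \<Longrightarrow> A \<noteq> {} \<Longrightarrow> 1 \<le> n \<Longrightarrow>
      \<exists>k\<in>{1..n}. dyadic_entropy_number n (absolutely_convex hull A)
        \<le> C * (real k powr \<beta> * anchored_entropy A k) * real n powr (- \<beta>)"
    using hull_entropy_le_anchored_entropy[OF signs \<rho> assms(2) \<beta>(1,3)] by blast
  let ?L = "\<lambda>\<gamma> n. log 2 (real n + 1) powr (- \<gamma>)"
  let ?e = "\<lambda>n A. dyadic_entropy_number n A"
  let ?h = "\<lambda>A :: 'a set. absolutely_convex hull A"
  have sums: "\<exists>c>0. \<forall>A N. bounded A \<longrightarrow> A \<noteq> {} \<longrightarrow>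
      (\<Sum>n=1..N. ?L \<gamma> n * real n powr (s / r - 1) * ?e n (?h A) powr s)
        \<le> c * (\<Sum>n=1..N. ?L \<gamma> n * real n powr (s / r - 1) * anchored_entropy A n powr s)"
    if s: "0 < s" for s \<gamma> :: real
  proof -
    have sv: "s * v - 1 = s / r - 1" by (simp add: v_def)
    obtain c where c: "0 < c" and main: "\<And>(a :: nat \<Rightarrow> real) b N. antimono_on {1..} a \<Longrightarrow> (\<And>n. 1 \<le> n \<Longrightarrow> 0 \<le> a n) \<Longrightarrow>
      (\<And>n. 1 \<le> n \<Longrightarrow> 0 \<le> b n) \<Longrightarrow>
      (\<And>n. 1 \<le> n \<Longrightarrow> \<exists>k\<in>{1..n}. b n \<le> C * (real k powr \<beta> * a k) * real n powr (- \<beta>)) \<Longrightarrow>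
      (\<Sum>n=1..N. ?L \<gamma> n * real n powr (s * v - 1) * b n powr s)
        \<le> c * (\<Sum>n=1..N. ?L \<gamma> n * real n powr (s * v - 1) * a n powr s)"
      using log_weighted_hardy_sum[OF v(1) \<beta>(2) s C] by blast
    show ?thesis
    proof (intro exI[of _ c] conjI allI impI c)
      fix A :: "'a set" and N :: nat assume A: "bounded A" "A \<noteq> {}"
      show "(\<Sum>n=1..N. ?L \<gamma> n * real n powr (s / r - 1) * ?e n (?h A) powr s)
          \<le> c * (\<Sum>n=1..N. ?L \<gamma> n * real n powr (s / r - 1) * anchored_entropy A n powr s)"
        unfolding sv[symmetric]
        by (rule main[OF antimono_anchored_entropy[OF A] anchored_entropy_nonneg[OF A]
              dyadic_entropy_number_nonneg[OF bounded_absolutely_convex_hull[OF A(1)]] hull[OF A]])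
    qed
  qed
  obtain c2 where c2: "0 < c2" and sup:
    "\<And>a b n k. 0 \<le> a \<Longrightarrow> 1 \<le> k \<Longrightarrow> k \<le> n \<Longrightarrow>
      b \<le> C * (real k powr \<beta> * a) * real n powr (- \<beta>) \<Longrightarrow>
      ?L \<alpha> n * real n powr v * b \<le> c2 * (?L \<alpha> k * real k powr v * a)"
    using log_weighted_hardy_term[OF \<beta>(2) C] by blast
  have sups: "\<exists>k\<in>{1..n}. ?L \<alpha> n * real n powr (1 / r) * ?e n (?h A)
      \<le> c2 * (?L \<alpha> k * real k powr (1 / r) * anchored_entropy A k)"
    if A: "bounded A" "A \<noteq> {}" and n: "1 \<le> n" for A :: "'a set" and n
  proof -
    obtain k where k: "k \<in> {1..n}"
      "?e n (?h A) \<le> C * (real k powr \<beta> * anchored_entropy A k) * real n powr (- \<beta>)"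
      using hull[OF A n] by blast
    show ?thesis
      using sup[OF anchored_entropy_nonneg[OF A] _ _ k(2)] k(1) unfolding v_def by auto
  qed
  show ?thesis
  proof (intro conjI allI impI)
    fix s :: real assume s: "0 < s"
    obtain c1 where c1: "0 < c1" and sum1: "\<And>A N. bounded A \<Longrightarrow> A \<noteq> {} \<Longrightarrow>
        (\<Sum>n=1..N. ?L \<alpha> n * real n powr (s / r - 1) * ?e n (?h A) powr s)
          \<le> c1 * (\<Sum>n=1..N. ?L \<alpha> n * real n powr (s / r - 1) * anchored_entropy A n powr s)"
      using sums[OF s, of \<alpha>] by blast
    have c: "0 < max c1 c2" using c1 by simp
    show "\<exists>c>0. \<forall>(N::nat) (A :: 'a set).
        1 \<le> N \<longrightarrow> totally_bounded A \<longrightarrow> 0 < entropy_number 1 A \<longrightarrow>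
        (let c\<^sub>A = (SUP x\<in>A. norm x) / entropy_number 1 A in
          (\<Sum>n=1..N. ?L \<alpha> n * real n powr (s / r - 1) * ?e n (?h A) powr s)
            \<le> c * c\<^sub>A powr s * (\<Sum>n=1..N. ?L \<alpha> n * real n powr (s / r - 1) * ?e n A powr s) \<and>
          (SUP n\<in>{1..N}. ?L \<alpha> n * real n powr (1 / r) * ?e n (?h A))
            \<le> c * c\<^sub>A * (SUP n\<in>{1..N}. ?L \<alpha> n * real n powr (1 / r) * ?e n A))"
      unfolding Let_def
    proof (intro exI[of _ "max c1 c2"] conjI[OF c] allI impI conjI)
      fix N :: nat and A :: "'a set"
      assume N: "1 \<le> N" and tb: "totally_bounded A" and pos: "0 < entropy_number 1 A"
      have A: "bounded A" "A \<noteq> {}"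
        using tb pos by (auto dest: totally_bounded_imp_bounded nonempty_of_entropy_number_pos)
      define cA where "cA = (SUP x\<in>A. norm x) / entropy_number 1 A"
      have cA: "0 \<le> cA" unfolding cA_def using SUP_norm_nonneg[OF A] pos by simp
      have le: "anchored_entropy A n \<le> cA * ?e n A" if "1 \<le> n" for n
        unfolding cA_def using anchored_entropy_le[OF A(1) pos that] .
      have e: "0 \<le> ?e n A" for n using dyadic_entropy_number_nonneg[OF A(1)] .
      have "(\<Sum>n=1..N. ?L \<alpha> n * real n powr (s / r - 1) * ?e n (?h A) powr s)
          \<le> c1 * (\<Sum>n=1..N. ?L \<alpha> n * real n powr (s / r - 1) * anchored_entropy A n powr s)"
        by (rule sum1[OF A])
      also have "\<dots> \<le> max c1 c2 * (\<Sum>n=1..N. ?L \<alpha> n * real n powr (s / r - 1) * (cA * ?e n A) powr s)"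
        using le s c anchored_entropy_nonneg[OF A]
        by (intro mult_mono sum_mono mult_left_mono powr_mono2 sum_nonneg) auto
      also have "\<dots> = max c1 c2 * cA powr s * (\<Sum>n=1..N. ?L \<alpha> n * real n powr (s / r - 1) * ?e n A powr s)"
        using cA e by (simp add: powr_mult sum_distrib_left mult_ac)
      finally have 1: "(\<Sum>n=1..N. ?L \<alpha> n * real n powr (s / r - 1) * ?e n (?h A) powr s)
          \<le> max c1 c2 * cA powr s * (\<Sum>n=1..N. ?L \<alpha> n * real n powr (s / r - 1) * ?e n A powr s)" .
      let ?S = "SUP n\<in>{1..N}. ?L \<alpha> n * real n powr (1 / r) * ?e n A"
      have 2: "(SUP n\<in>{1..N}. ?L \<alpha> n * real n powr (1 / r) * ?e n (?h A)) \<le> max c1 c2 * cA * ?S"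
      proof (rule cSUP_least)
        fix n assume n: "n \<in> {1..N}"
        then obtain k where k: "k \<in> {1..n}" "?L \<alpha> n * real n powr (1 / r) * ?e n (?h A)
            \<le> c2 * (?L \<alpha> k * real k powr (1 / r) * anchored_entropy A k)"
          using sups[OF A, of n] by auto
        note k(2)
        also have "c2 * (?L \<alpha> k * real k powr (1 / r) * anchored_entropy A k)
            \<le> max c1 c2 * (?L \<alpha> k * real k powr (1 / r) * (cA * ?e k A))"
          using le[of k] k(1) c2 anchored_entropy_nonneg[OF A]
          by (intro mult_mono mult_left_mono) auto
        also have "\<dots> = max c1 c2 * cA * (?L \<alpha> k * real k powr (1 / r) * ?e k A)"
          by (simp only: mult_ac)
        also have "\<dots> \<le> max c1 c2 * cA * ?S"
        proof (rule mult_left_mono)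
          show "?L \<alpha> k * real k powr (1 / r) * ?e k A \<le> ?S"
            using k(1) n by (intro cSUP_upper bdd_above_finite) auto
        qed (use c cA in simp)
        finally show "?L \<alpha> n * real n powr (1 / r) * ?e n (?h A) \<le> max c1 c2 * cA * ?S" .
      qed (use N in simp)
      show "(\<Sum>n=1..N. ?L \<alpha> n * real n powr (s / r - 1) * ?e n (?h A) powr s)
          \<le> max c1 c2 * ((SUP x\<in>A. norm x) / entropy_number 1 A) powr s
            * (\<Sum>n=1..N. ?L \<alpha> n * real n powr (s / r - 1) * ?e n A powr s)"
        using 1 unfolding cA_def .
      show "(SUP n\<in>{1..N}. ?L \<alpha> n * real n powr (1 / r) * ?e n (?h A))
          \<le> max c1 c2 * ((SUP x\<in>A. norm x) / entropy_number 1 A) * ?S"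
        using 2 unfolding cA_def .
    qed
  next
    fix s :: ereal and A :: "'a set"
    assume s: "0 < s" and tb: "totally_bounded A"
    have bA: "bounded A" using tb by (rule totally_bounded_imp_bounded)
    have bH: "bounded (?h A)" using bA by (rule bounded_absolutely_convex_hull)
    show "(\<lambda>n. ?e n A) \<in> lorentz_seq r s \<alpha> \<longleftrightarrow> (\<lambda>n. ?e n (?h A)) \<in> lorentz_seq r s \<alpha>"
    proof
      assume "(\<lambda>n. ?e n (?h A)) \<in> lorentz_seq r s \<alpha>"
      then show "(\<lambda>n. ?e n A) \<in> lorentz_seq r s \<alpha>"
        by (rule lorentz_seq_entropy_mono[OF bH hull_subset s])
    next
      assume mem: "(\<lambda>n. ?e n A) \<in> lorentz_seq r s \<alpha>"
      show "(\<lambda>n. ?e n (?h A)) \<in> lorentz_seq r s \<alpha>"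
      proof (cases "A = {}")
        case True
        have "?h {} \<subseteq> {}" by (rule hull_minimal) (auto simp: absolutely_convex_def)
        then show ?thesis using mem True by simp
      next
        case ne: False
        let ?R = "SUP x\<in>A. norm x"
        show ?thesis
        proof (cases "s = \<infinity>")
          case True
          then obtain M where M: "\<And>n. n \<in> {1..} \<Longrightarrow> ?L \<alpha> n * real n powr (1 / r) * ?e n A \<le> M"
            using mem unfolding lorentz_seq_entropy_iff[OF bA] by (auto simp: bdd_above_def)
          have "?L \<alpha> n * real n powr (1 / r) * ?e n (?h A) \<le> c2 * max M ?R" if n: "n \<in> {1..}" for n
          proof -
            obtain k where k: "k \<in> {1..n}" "?L \<alpha> n * real n powr (1 / r) * ?e n (?h A)
                \<le> c2 * (?L \<alpha> k * real k powr (1 / r) * anchored_entropy A k)"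
              using sups[OF bA ne, of n] n by auto
            have "?L \<alpha> k * real k powr (1 / r) * anchored_entropy A k \<le> max M ?R"
              using M[of k] k(1) by (cases "k = 1") (auto simp: anchored_entropy_def le_max_iff_disj)
            with k(2) c2 show ?thesis by (meson less_imp_le mult_left_mono order_trans)
          qed
          then have "bdd_above ((\<lambda>n. ?L \<alpha> n * real n powr (1 / r) * ?e n (?h A)) ` {1..})"
            by (rule bdd_aboveI2)
          then show ?thesis
            unfolding lorentz_seq_entropy_iff[OF bH] using True by simp
        next
          case False
          define t where "t = real_of_ereal s"
          have t: "0 < t" unfolding t_def using False s by (cases s) auto
          let ?w = "\<lambda>n. log 2 (real n + 1) powr (- \<alpha> * t) * real n powr (t / r - 1)"
          obtain c where c: "0 < c" and main: "\<And>N. (\<Sum>n=1..N. ?w n * ?e n (?h A) powr t)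
              \<le> c * (\<Sum>n=1..N. ?w n * anchored_entropy A n powr t)"
            using sums[OF t, of "\<alpha> * t"] bA ne by auto
          have summable: "(\<lambda>n. ?w n * ?e n A powr t) summable_on {1..}"
            using mem False unfolding lorentz_seq_entropy_iff[OF bA] t_def by simp
          have "(\<lambda>n. ?w n * ?e n (?h A) powr t) summable_on {1..}"
          proof (rule nonneg_bdd_above_summable_on)
            show "bdd_above (sum (\<lambda>n. ?w n * ?e n (?h A) powr t) ` {F. F \<subseteq> {1..} \<and> finite F})"
            proof (rule bdd_aboveI2)
              fix F :: "nat set" assume "F \<in> {F. F \<subseteq> {1..} \<and> finite F}"
              then have F: "F \<subseteq> {1..}" "finite F" by auto
              define N where "N = Max (insert 0 F)"
              have "F \<subseteq> {1..N}" using F by (auto simp: N_def)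
              then have "(\<Sum>n\<in>F. ?w n * ?e n (?h A) powr t) \<le> (\<Sum>n=1..N. ?w n * ?e n (?h A) powr t)"
                by (intro sum_mono2) auto
              also have "\<dots> \<le> c * (\<Sum>n=1..N. ?w n * anchored_entropy A n powr t)"
                by (rule main)
              \<comment> \<open>The weight at \<open>n = 1\<close> equals \<open>1\<close>.\<close>
              also have "\<dots> \<le> c * (\<Sum>n=1..N. ?w n * ?e n A powr t + (if n = 1 then ?R powr t else 0))"
                using c by (intro mult_left_mono sum_mono) (auto simp: anchored_entropy_def)
              also have "\<dots> = c * ((\<Sum>n=1..N. ?w n * ?e n A powr t) + (\<Sum>n=1..N. if n = 1 then ?R powr t else 0))"
                by (simp only: sum.distrib)
              also have "\<dots> \<le> c * ((\<Sum>\<^sub>\<infinity>n\<in>{1..}. ?w n * ?e n A powr t) + ?R powr t)"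
                using c finite_sum_le_infsum[OF summable, of "{1..N}"]
                by (intro mult_left_mono add_mono) (auto simp: sum.delta)
              finally show "(\<Sum>n\<in>F. ?w n * ?e n (?h A) powr t)
                  \<le> c * ((\<Sum>\<^sub>\<infinity>n\<in>{1..}. ?w n * ?e n A powr t) + ?R powr t)" .
            qed
          qed simp
          then show ?thesis
            unfolding lorentz_seq_entropy_iff[OF bH] t_def using False by simp
        qed
      qed
    qed
  qed
qed

end
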